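(* Let $G$ be a torsion-free non-elementary hyperbolic group and let $k\ge 2$ be an integer. Then the full Andrews-Curtis group $FAC_k(G)$ acts faithfully on every nontrivial orbit of its action on $G^k$. That is, for every orbit $O\subseteq G^k$ of $FAC_k(G)$ with $O\neq\{(1,1,\ldots,1)\}$, the only element of $FAC_k(G)$ fixing every point of $O$ is the identity.
   Context: "Hyperbolic" means word-hyperbolic in the sense of Gromov. Such a group is non-elementary if it is not virtually cyclic (i.e. it has no cyclic subgroup of finite index). Let $G$ be a group, $k\ge 2$ an integer, and $G^k$ the direct power of $k$ copies of $G$. The elementary Andrews-Curtis transformations (AC-moves) on $G^k$ are the following bijections $G^k\to G^k$, where $1\le i,j\le k$: - $(R_{ij})$: $(u_1,\ldots,u_i,\ldots,u_k)\mapsto (u_1,\ldots,u_iu_j^{\pm1},\ldots,u_k)$, $i\neq j$; - $(L_{ij})$: $(u_1,\ldots,u_i,\ldots,u_k)\mapsto (u_1,\ldots,u_j^{\pm1}u_i,\ldots,u_k)$, $i\neq j$; - $(I_i)$: $(u_1,\ldots,u_i,\ldots,u_k)\mapsto (u_1,\ldots,u_i^{-1},\ldots,u_k)$; - $(C_{i,w})$: $(u_1,\ldots,u_i,\ldots,u_k)\mapsto (u_1,\ldots,u_i^{w},\ldots,u_k)$, $w\in G$, where $u^w=w^{-1}uw$ denotes conjugation. The full Andrews-Curtis group $FAC_k(G)$ is the subgroup of the symmetric group $Sym(G^k)$ generated by all these bijections; it acts on $G^k$. The trivial orbit is $\{(1,1,\ldots,1)\}$. *)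

theory Defs
  imports "HOL-Algebra.Algebra"
begin

section \<open>Hyperbolic groups\<close>

definition gromov_product :: "('a \<Rightarrow> 'a \<Rightarrow> real) \<Rightarrow> 'a \<Rightarrow> 'a \<Rightarrow> 'a \<Rightarrow> real" where
  "gromov_product d w x y = (d x w + d y w - d x y) / 2"

text \<open>Gromov's definition of a hyperbolic metric space. It does not require the space to be
  geodesic, so it applies directly to a group with a word metric.\<close>
definition gromov_hyperbolic :: "'a set \<Rightarrow> ('a \<Rightarrow> 'a \<Rightarrow> real) \<Rightarrow> bool" where
  "gromov_hyperbolic M d \<longleftrightarrow>
     (\<exists>\<delta>. \<forall>w\<in>M. \<forall>x\<in>M. \<forall>y\<in>M. \<forall>z\<in>M.
        gromov_product d w x z \<ge> min (gromov_product d w x y) (gromov_product d w y z) - \<delta>)"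

text \<open>The infimum in the word length is only meaningful for elements of the subgroup generated by
  \<open>S\<close>; below, \<open>S\<close> always generates \<open>G\<close>.\<close>
definition word_length :: "('a, 'b) monoid_scheme \<Rightarrow> 'a set \<Rightarrow> 'a \<Rightarrow> nat" where
  "word_length G S x =
     (LEAST n. \<exists>ws. set ws \<subseteq> S \<union> m_inv G ` S \<and> length ws = n \<and> foldr (\<otimes>\<^bsub>G\<^esub>) ws \<one>\<^bsub>G\<^esub> = x)"

definition word_metric :: "('a, 'b) monoid_scheme \<Rightarrow> 'a set \<Rightarrow> 'a \<Rightarrow> 'a \<Rightarrow> real" where
  "word_metric G S x y = real (word_length G S (inv\<^bsub>G\<^esub> x \<otimes>\<^bsub>G\<^esub> y))"

definition hyperbolic_group :: "('a, 'b) monoid_scheme \<Rightarrow> bool" where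
  "hyperbolic_group G \<longleftrightarrow>
     group G \<and>
     (\<exists>S. finite S \<and> S \<subseteq> carrier G \<and> generate G S = carrier G \<and>
        gromov_hyperbolic (carrier G) (word_metric G S))"

definition virtually_cyclic :: "('a, 'b) monoid_scheme \<Rightarrow> bool" where
  "virtually_cyclic G \<longleftrightarrow> (\<exists>g\<in>carrier G. finite (rcosets\<^bsub>G\<^esub> (generate G {g})))"

definition torsion_free :: "('a, 'b) monoid_scheme \<Rightarrow> bool" where
  "torsion_free G \<longleftrightarrow>
     (\<forall>g\<in>carrier G. \<forall>n::nat. n > 0 \<longrightarrow> g [^]\<^bsub>G\<^esub> n = \<one>\<^bsub>G\<^esub> \<longrightarrow> g = \<one>\<^bsub>G\<^esub>)"


section \<open>The full Andrews-Curtis group\<close>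

abbreviation direct_power :: "('a, 'b) monoid_scheme \<Rightarrow> nat \<Rightarrow> (nat \<Rightarrow> 'a) monoid" where
  "direct_power G k \<equiv> product_group {1..k} (\<lambda>_. G)"

text \<open>The moves are restricted to the carrier because \<^const>\<open>BijGroup\<close> consists of
  extensional functions.\<close>

definition AC_right :: "('a, 'b) monoid_scheme \<Rightarrow> nat \<Rightarrow> nat \<Rightarrow> nat \<Rightarrow> (nat \<Rightarrow> 'a) \<Rightarrow> nat \<Rightarrow> 'a" where
  "AC_right G k i j = (\<lambda>u\<in>carrier (direct_power G k). u(i := u i \<otimes>\<^bsub>G\<^esub> u j))"

definition AC_right_inv :: "('a, 'b) monoid_scheme \<Rightarrow> nat \<Rightarrow> nat \<Rightarrow> nat \<Rightarrow> (nat \<Rightarrow> 'a) \<Rightarrow> nat \<Rightarrow> 'a" where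
  "AC_right_inv G k i j = (\<lambda>u\<in>carrier (direct_power G k). u(i := u i \<otimes>\<^bsub>G\<^esub> inv\<^bsub>G\<^esub> (u j)))"

definition AC_left :: "('a, 'b) monoid_scheme \<Rightarrow> nat \<Rightarrow> nat \<Rightarrow> nat \<Rightarrow> (nat \<Rightarrow> 'a) \<Rightarrow> nat \<Rightarrow> 'a" where
  "AC_left G k i j = (\<lambda>u\<in>carrier (direct_power G k). u(i := u j \<otimes>\<^bsub>G\<^esub> u i))"

definition AC_left_inv :: "('a, 'b) monoid_scheme \<Rightarrow> nat \<Rightarrow> nat \<Rightarrow> nat \<Rightarrow> (nat \<Rightarrow> 'a) \<Rightarrow> nat \<Rightarrow> 'a" where
  "AC_left_inv G k i j = (\<lambda>u\<in>carrier (direct_power G k). u(i := inv\<^bsub>G\<^esub> (u j) \<otimes>\<^bsub>G\<^esub> u i))"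

definition AC_inv :: "('a, 'b) monoid_scheme \<Rightarrow> nat \<Rightarrow> nat \<Rightarrow> (nat \<Rightarrow> 'a) \<Rightarrow> nat \<Rightarrow> 'a" where
  "AC_inv G k i = (\<lambda>u\<in>carrier (direct_power G k). u(i := inv\<^bsub>G\<^esub> (u i)))"

definition AC_conj :: "('a, 'b) monoid_scheme \<Rightarrow> nat \<Rightarrow> nat \<Rightarrow> 'a \<Rightarrow> (nat \<Rightarrow> 'a) \<Rightarrow> nat \<Rightarrow> 'a" where
  "AC_conj G k i w =
     (\<lambda>u\<in>carrier (direct_power G k). u(i := inv\<^bsub>G\<^esub> w \<otimes>\<^bsub>G\<^esub> u i \<otimes>\<^bsub>G\<^esub> w))"

definition AC_moves :: "('a, 'b) monoid_scheme \<Rightarrow> nat \<Rightarrow> ((nat \<Rightarrow> 'a) \<Rightarrow> nat \<Rightarrow> 'a) set" where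
  "AC_moves G k =
     {AC_right G k i j | i j. i \<in> {1..k} \<and> j \<in> {1..k} \<and> i \<noteq> j} \<union>
     {AC_right_inv G k i j | i j. i \<in> {1..k} \<and> j \<in> {1..k} \<and> i \<noteq> j} \<union>
     {AC_left G k i j | i j. i \<in> {1..k} \<and> j \<in> {1..k} \<and> i \<noteq> j} \<union>
     {AC_left_inv G k i j | i j. i \<in> {1..k} \<and> j \<in> {1..k} \<and> i \<noteq> j} \<union>
     {AC_inv G k i | i. i \<in> {1..k}} \<union>
     {AC_conj G k i w | i w. i \<in> {1..k} \<and> w \<in> carrier G}"

definition FAC :: "('a, 'b) monoid_scheme \<Rightarrow> nat \<Rightarrow> ((nat \<Rightarrow> 'a) \<Rightarrow> nat \<Rightarrow> 'a) monoid" where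
  "FAC G k = subgroup_generated (BijGroup (carrier (direct_power G k))) (AC_moves G k)"

text \<open>The group \<^const>\<open>FAC\<close> acts on the direct power by evaluation, i.e. by
  \<open>\<lambda>f. f\<close>.\<close>
abbreviation FAC_orbits :: "('a, 'b) monoid_scheme \<Rightarrow> nat \<Rightarrow> (nat \<Rightarrow> 'a) set set" where
  "FAC_orbits G k \<equiv> orbits (FAC G k) (carrier (direct_power G k)) (\<lambda>f. f)"


subsection \<open>Well-formedness\<close>

lemma restrict_in_BijI:
  assumes "\<And>u. u \<in> A \<Longrightarrow> f u \<in> A" "\<And>u. u \<in> A \<Longrightarrow> g u \<in> A"
    "\<And>u. u \<in> A \<Longrightarrow> g (f u) = u" "\<And>u. u \<in> A \<Longrightarrow> f (g u) = u"
  shows "(\<lambda>u\<in>A. f u) \<in> carrier (BijGroup A)"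
proof -
  have "bij_betw f A A"
    by (rule bij_betw_byWitness[where f' = g]) (use assms in auto)
  then have "bij_betw (\<lambda>u\<in>A. f u) A A"
    using bij_betw_cong[of A "restrict f A" f A] by simp
  then show ?thesis
    by (simp add: BijGroup_def Bij_def)
qed

lemma AC_moves_in_BijGroup:
  fixes G (structure)
  assumes "group G"
  shows "AC_moves G k \<subseteq> carrier (BijGroup (carrier (direct_power G k)))"
proof -
  interpret group G by fact
  let ?X = "carrier (direct_power G k)"
  have mem: "u(i := a) \<in> ?X" if "u \<in> ?X" "i \<in> {1..k}" "a \<in> carrier G" for u i a
    using that by (auto simp: PiE_iff extensional_def)
  have comp: "u i \<in> carrier G" if "u \<in> ?X" "i \<in> {1..k}" for u i
    using that by (auto simp: PiE_iff)
  have can: "a \<otimes> b \<otimes> inv b = a" "a \<otimes> inv b \<otimes> b = a" "inv b \<otimes> (b \<otimes> a) = a" "b \<otimes> (inv b \<otimes> a) = a"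
    if "a \<in> carrier G" "b \<in> carrier G" for a b
    using that by (simp_all add: m_assoc m_assoc[symmetric, of b] m_assoc[symmetric, of "inv b"])
  have conj: "b \<otimes> (inv b \<otimes> a \<otimes> b) \<otimes> inv b = a" "inv b \<otimes> (b \<otimes> a \<otimes> inv b) \<otimes> b = a"
    if "a \<in> carrier G" "b \<in> carrier G" for a b
    using that by (metis can inv_closed m_assoc m_closed)+
  have "AC_right G k i j \<in> carrier (BijGroup ?X)"
    if "i \<in> {1..k}" "j \<in> {1..k}" "i \<noteq> j" for i j
    unfolding AC_right_def
    by (rule restrict_in_BijI[where g = "\<lambda>u. u(i := u i \<otimes> inv (u j))"];
        use that in \<open>simp add: mem comp can del: carrier_product_group One_nat_def\<close>)
  moreover have "AC_right_inv G k i j \<in> carrier (BijGroup ?X)"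
    if "i \<in> {1..k}" "j \<in> {1..k}" "i \<noteq> j" for i j
    unfolding AC_right_inv_def
    by (rule restrict_in_BijI[where g = "\<lambda>u. u(i := u i \<otimes> u j)"];
        use that in \<open>simp add: mem comp can del: carrier_product_group One_nat_def\<close>)
  moreover have "AC_left G k i j \<in> carrier (BijGroup ?X)"
    if "i \<in> {1..k}" "j \<in> {1..k}" "i \<noteq> j" for i j
    unfolding AC_left_def
    by (rule restrict_in_BijI[where g = "\<lambda>u. u(i := inv (u j) \<otimes> u i)"];
        use that in \<open>simp add: mem comp can del: carrier_product_group One_nat_def\<close>)
  moreover have "AC_left_inv G k i j \<in> carrier (BijGroup ?X)"
    if "i \<in> {1..k}" "j \<in> {1..k}" "i \<noteq> j" for i j
    unfolding AC_left_inv_def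
    by (rule restrict_in_BijI[where g = "\<lambda>u. u(i := u j \<otimes> u i)"];
        use that in \<open>simp add: mem comp can del: carrier_product_group One_nat_def\<close>)
  moreover have "AC_inv G k i \<in> carrier (BijGroup ?X)" if "i \<in> {1..k}" for i
    unfolding AC_inv_def
    by (rule restrict_in_BijI[where g = "\<lambda>u. u(i := inv (u i))"];
        use that in \<open>simp add: mem comp del: carrier_product_group One_nat_def\<close>)
  moreover have "AC_conj G k i w \<in> carrier (BijGroup ?X)" if "i \<in> {1..k}" "w \<in> carrier G" for i w
    unfolding AC_conj_def
    by (rule restrict_in_BijI[where g = "\<lambda>u. u(i := w \<otimes> u i \<otimes> inv w)"];
        use that in \<open>simp add: mem comp conj del: carrier_product_group One_nat_def\<close>)
  ultimately show ?thesis
    unfolding AC_moves_def by blast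
qed

lemma carrier_FAC:
  assumes "group G"
  shows "carrier (FAC G k) = generate (BijGroup (carrier (direct_power G k))) (AC_moves G k)"
  unfolding FAC_def carrier_subgroup_generated
  using AC_moves_in_BijGroup[OF assms, of k] by (simp add: Int_absorb1)

lemma group_action_FAC: "group_action (FAC G k) (carrier (direct_power G k)) (\<lambda>f. f)"
proof -
  let ?B = "BijGroup (carrier (direct_power G k))"
  interpret B: group ?B by (rule group_BijGroup)
  have "(\<lambda>f. f) \<in> hom (FAC G k) ?B"
    using B.carrier_subgroup_generated_subset[of "AC_moves G k"]
    unfolding FAC_def by (auto simp: hom_def)
  then show ?thesis
    unfolding group_action_def group_hom_def group_hom_axioms_def FAC_def
    using B.group_subgroup_generated B.is_group by blast
qed

end

theory Submission
  imports Defs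
begin

text \<open>
  Every element of the full Andrews-Curtis group moves each coordinate by a word in the coordinates
  with constants from \<open>G\<close> (\<open>FAC_coordinatewise_word\<close>). If such an element fixes an orbit pointwise,
  then for each \<open>i\<close> the word \<open>\<phi>\<^sub>i(u) u\<^sub>i\<inverse>\<close> is trivial on that orbit. The theorem therefore says that a
  word with constants that is trivial on a nontrivial orbit is trivial on all of \<open>G\<^sup>k\<close>.

  Orbits are large: conjugating \<open>u\<^sub>j\<close>, multiplying \<open>u\<^sub>i\<close> by it and conjugating back shows that \<open>u\<^sub>i\<close>
  may be multiplied by any element of the normal closure of \<open>u\<^sub>j\<close>, for \<open>i \<noteq> j\<close>
  (\<open>AC_orbit_normal_closure\<close>). This permits freeing the variables one at a time
  (\<open>word_map_vanishing_on_orbit\<close>), so that only words in one variable matter. What is needed about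
  them is: if \<open>w(x)\<close> is trivial for all \<open>x \<noteq> 1\<close> in a coset \<open>u N\<close> of a nontrivial normal subgroup,
  then \<open>w\<close> is trivial on \<open>G\<close> (\<open>word_vanishing_on_coset\<close>).

  This is where hyperbolicity enters. A reduced word with at least one letter is evaluated at
  \<open>x = b\<^sup>m v\<close>, where \<open>v \<in> u N\<close> and \<open>b \<in> N\<close> is loxodromic. Its value is a product of powers \<open>b\<^sup>\<plusminus>\<^sup>m\<close> separated
  by connecting elements that lie in a finite set independent of \<open>m\<close>. A suitable \<open>v\<close> makes all of
  them nontrivial, and \<open>b\<close> can be chosen such that none of them conjugates a nontrivial power of \<open>b\<close>
  to a power of \<open>b\<close> (\<open>exists_conjugate_avoiding\<close>): among the conjugates \<open>b = s a s\<inverse>\<close> of one loxodromic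
  element \<open>a\<close>, those that are unsuitable have \<open>s\<close> in finitely many cosets of the cyclic group of \<open>a\<close>,
  and these do not cover a group that is not virtually cyclic. Then
  consecutive powers of \<open>b\<close> diverge after a distance bounded independently of \<open>m\<close>
  (\<open>bounded_divergence\<close>), the partial products form a broken line that hardly backtracks, and its
  endpoints are far apart when \<open>m\<close> is large (\<open>reduced_word_nontrivial_on_coset\<close>).

  The required facts about hyperbolic groups are derived directly from the four-point inequality,
  finiteness of balls and the existence of points on geodesics.
  Most of them rest on one pigeonhole argument: if two orbits of cyclic groups stay within a fixed
  distance for long enough, then two of the connecting elements coincide, because balls are
  finite, and this gives a relation. It shows that elements of infinite order have loxodromic
  powers, that long parallel axes are commensurable, and that an element preserving an axis up to
  commensurability has a power in the corresponding cyclic group.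
\<close>

section \<open>Groups with a hyperbolic length function\<close>

text \<open>
  The slack \<open>e\<close> at both ends lets the lemma be applied when the target value is only approximately
  between the first and the last value.
\<close>

lemma discrete_intermediate_value:
  fixes f :: "nat \<Rightarrow> real"
  assumes start: "f 0 \<le> v + e" and stop: "v \<le> f n + e"
    and step: "\<And>i. i < n \<Longrightarrow> \<bar>f (Suc i) - f i\<bar> \<le> s" and "s \<ge> 0" "e \<ge> 0"
  shows "\<exists>i\<le>n. \<bar>f i - v\<bar> \<le> s + e"
proof -
  define i where "i = (LEAST i. v \<le> f i + e)"
  have i: "v \<le> f i + e" "i \<le> n"
    unfolding i_def using stop by (auto intro: LeastI Least_le)
  show ?thesis
  proof (cases i)
    case 0
    then show ?thesis using i start \<open>s \<ge> 0\<close> by (intro exI[of _ 0]) auto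
  next
    case (Suc j)
    then have "\<not> v \<le> f j + e"
      using not_less_Least[of j "\<lambda>i. v \<le> f i + e"] unfolding i_def by simp
    moreover have "\<bar>f (Suc j) - f j\<bar> \<le> s" using step Suc i by simp
    ultimately show ?thesis using i Suc \<open>e \<ge> 0\<close> by (intro exI[of _ i]) (simp add: abs_le_iff)
  qed
qed

text \<open>
  The properties of a word length that the geometric part of the argument uses. Points of the
  metric space are the group elements themselves, so geodesics are replaced by the points at integer
  distance in \<open>geodesic_point\<close>, which a prefix of a shortest word provides.
\<close>

locale hyperbolic_length = group G for G (structure) +
  fixes len :: "'a \<Rightarrow> real" and \<delta> :: real
  assumes len_one: "len \<one> = 0"
    and len_inv: "x \<in> carrier G \<Longrightarrow> len (inv x) = len x"
    and len_mult: "x \<in> carrier G \<Longrightarrow> y \<in> carrier G \<Longrightarrow> len (x \<otimes> y) \<le> len x + len y"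
    and finite_ball: "finite {x \<in> carrier G. len x \<le> r}"
    and geodesic_point: "x \<in> carrier G \<Longrightarrow> real n \<le> len x \<Longrightarrow>
      \<exists>p \<in> carrier G. len p = real n \<and> len (inv p \<otimes> x) = len x - real n"
    and delta_nonneg: "\<delta> \<ge> 0"
    and four_point: "w \<in> carrier G \<Longrightarrow> x \<in> carrier G \<Longrightarrow> y \<in> carrier G \<Longrightarrow> z \<in> carrier G \<Longrightarrow>
      gromov_product (\<lambda>x y. len (inv x \<otimes> y)) w x z \<ge>
        min (gromov_product (\<lambda>x y. len (inv x \<otimes> y)) w x y)
            (gromov_product (\<lambda>x y. len (inv x \<otimes> y)) w y z) - \<delta>"
begin

definition d :: "'a \<Rightarrow> 'a \<Rightarrow> real" where
  "d x y = len (inv x \<otimes> y)"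

abbreviation gp :: "'a \<Rightarrow> 'a \<Rightarrow> 'a \<Rightarrow> real" where
  "gp \<equiv> gromov_product d"

lemma d_one [simp]: "x \<in> carrier G \<Longrightarrow> d \<one> x = len x"
  by (simp add: d_def)

lemma d_self [simp]: "x \<in> carrier G \<Longrightarrow> d x x = 0"
  by (simp add: d_def len_one)

lemma d_sym: "x \<in> carrier G \<Longrightarrow> y \<in> carrier G \<Longrightarrow> d x y = d y x"
  unfolding d_def by (metis inv_closed inv_inv inv_mult_group len_inv m_closed)

lemma d_one_right [simp]: "x \<in> carrier G \<Longrightarrow> d x \<one> = len x"
  using d_sym[of x \<one>] by simp

lemma mult_inv_cancel:
  assumes "x \<in> carrier G" "y \<in> carrier G"
  shows "inv x \<otimes> (x \<otimes> y) = y" "x \<otimes> (inv x \<otimes> y) = y" "y \<otimes> x \<otimes> inv x = y" "y \<otimes> inv x \<otimes> x = y"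
  using assms by (simp_all add: m_assoc) (simp_all flip: m_assoc)

lemma d_triangle:
  assumes "x \<in> carrier G" "y \<in> carrier G" "z \<in> carrier G"
  shows "d x z \<le> d x y + d y z"
proof -
  have "inv x \<otimes> z = (inv x \<otimes> y) \<otimes> (inv y \<otimes> z)"
    using assms by (simp add: m_assoc mult_inv_cancel)
  then show ?thesis
    unfolding d_def using len_mult[of "inv x \<otimes> y" "inv y \<otimes> z"] assms by simp
qed

lemma d_nonneg: "x \<in> carrier G \<Longrightarrow> y \<in> carrier G \<Longrightarrow> d x y \<ge> 0"
  using d_triangle[of x y x] d_sym[of x y] by simp

lemma len_nonneg: "x \<in> carrier G \<Longrightarrow> len x \<ge> 0"
  using d_nonneg[of \<one> x] by simp

lemma d_translate [simp]:
  assumes "g \<in> carrier G" "x \<in> carrier G" "y \<in> carrier G"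
  shows "d (g \<otimes> x) (g \<otimes> y) = d x y"
  using assms by (simp add: d_def inv_mult_group m_assoc mult_inv_cancel)

lemma d_mult_right [simp]: "x \<in> carrier G \<Longrightarrow> y \<in> carrier G \<Longrightarrow> d x (x \<otimes> y) = len y"
  by (simp add: d_def mult_inv_cancel)

lemma gp_translate [simp]:
  "g \<in> carrier G \<Longrightarrow> w \<in> carrier G \<Longrightarrow> x \<in> carrier G \<Longrightarrow> y \<in> carrier G \<Longrightarrow>
    gp (g \<otimes> w) (g \<otimes> x) (g \<otimes> y) = gp w x y"
  by (simp add: gromov_product_def)

lemma gp_sym: "x \<in> carrier G \<Longrightarrow> y \<in> carrier G \<Longrightarrow> gp w x y = gp w y x"
  using d_sym[of x y] by (simp add: gromov_product_def)

lemma gp_nonneg: "w \<in> carrier G \<Longrightarrow> x \<in> carrier G \<Longrightarrow> y \<in> carrier G \<Longrightarrow> gp w x y \<ge> 0"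
  using d_triangle[of x w y] d_sym[of w y] by (simp add: gromov_product_def)

lemma gp_le: "w \<in> carrier G \<Longrightarrow> x \<in> carrier G \<Longrightarrow> y \<in> carrier G \<Longrightarrow> gp w x y \<le> d w x"
  using d_triangle[of y x w] d_sym[of w x] d_sym[of x y] by (simp add: gromov_product_def)

text \<open>
  The two Gromov products at the ends of a side of a triangle add up to the length of that side.
  Hence a lower bound on one is the same as an upper bound on the other.
\<close>

lemma gp_swap: 
  "p \<in> carrier G \<Longrightarrow> x \<in> carrier G \<Longrightarrow> y \<in> carrier G \<Longrightarrow> gp x p y = d x p - gp p x y"
  using d_sym[of x p] d_sym[of y x] d_sym[of y p] by (simp add: gromov_product_def field_simps)

lemma gp_move_base:
  assumes "w \<in> carrier G" "w' \<in> carrier G" "x \<in> carrier G" "y \<in> carrier G"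
  shows "gp w x y \<le> gp w' x y + d w w'"
  using assms d_triangle[of x w' w] d_triangle[of y w' w] d_sym[of w w']
  by (simp add: gromov_product_def field_simps)

lemma gp_move_point:
  assumes "w \<in> carrier G" "x \<in> carrier G" "x' \<in> carrier G" "y \<in> carrier G"
  shows "gp w x y \<le> gp w x' y + d x x'"
  using assms d_triangle[of x x' w] d_triangle[of x' x y] d_sym[of x x']
  by (simp add: gromov_product_def field_simps)

lemma gp_min:
  assumes "w \<in> carrier G" "x \<in> carrier G" "y \<in> carrier G" "z \<in> carrier G"
  shows "gp w x z \<ge> min (gp w x y) (gp w y z) - \<delta>"
proof -
  have "(\<lambda>x y. len (inv x \<otimes> y)) = d"
    by (simp add: d_def fun_eq_iff)
  with four_point[OF assms] show ?thesis by simp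
qed

lemma gp_min_ge:
  assumes "w \<in> carrier G" "x \<in> carrier G" "y \<in> carrier G" "z \<in> carrier G"
    and "gp w x y \<ge> r" "gp w y z \<ge> r"
  shows "gp w x z \<ge> r - \<delta>"
  using gp_min[OF assms(1-4)] assms(5,6) by linarith

text \<open>
  The form of the four-point inequality that moves a bound along: \<open>y\<close> and \<open>z\<close> share a long initial
  segment seen from \<open>w\<close>, so \<open>x\<close>, which diverges early from \<open>z\<close>, also diverges early from \<open>y\<close>.
\<close>

lemma gp_min_le:
  assumes "w \<in> carrier G" "x \<in> carrier G" "y \<in> carrier G" "z \<in> carrier G"
    and "gp w x z \<le> r" "gp w y z > r + \<delta>"
  shows "gp w x y \<le> r + \<delta>"
  using gp_min[OF assms(1-4)] assms(5,6) by linarith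

text \<open>
  A small Gromov product \<open>gp p x y\<close> means that \<open>p\<close> is near a geodesic from \<open>x\<close> to \<open>y\<close>. Two such
  points are close to each other if they have about the same distance from \<open>x\<close>.
\<close>

lemma close_if_between:
  assumes [simp]: "x \<in> carrier G" "y \<in> carrier G" "p \<in> carrier G" "q \<in> carrier G"
    and p: "gp p x y \<le> c" and q: "gp q x y \<le> c"
  shows "d p q \<le> \<bar>d x p - d x q\<bar> + 2 * c + 2 * \<delta>"
proof -
  define m where "m = min (d x p) (d x q) - c"
  have "gp x p y \<ge> m" "gp x y q \<ge> m"
    using p q gp_swap[of p x y] gp_swap[of q x y] gp_sym[of y q x] by (simp_all add: m_def)
  then have "gp x p q \<ge> m - \<delta>"
    by (intro gp_min_ge) auto
  moreover have "gp x p q = (d x p + d x q - d p q) / 2"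
    using d_sym[of x p] d_sym[of x q] by (simp add: gromov_product_def)
  ultimately show ?thesis
    by (cases "d x p \<le> d x q") (simp_all add: m_def)
qed

section \<open>Loxodromic elements\<close>

text \<open>
  The powers of \<open>a\<close> form a quasi-geodesic line: powers with exponents of opposite sign diverge at
  the identity, and the length of the powers grows linearly. The additive constant \<open>e\<close> makes the
  notion visibly invariant under conjugation.
\<close>

definition loxodromic :: "'a \<Rightarrow> bool" where
  "loxodromic a \<longleftrightarrow> a \<in> carrier G \<and>
     (\<exists>c. \<forall>i j::int. i * j \<le> 0 \<longrightarrow> gp \<one> (a [^] i) (a [^] j) \<le> c) \<and>
     (\<exists>\<kappa>>0. \<exists>e. \<forall>n::nat. len (a [^] n) \<ge> \<kappa> * real n - e)"

text \<open>
  The assumption says that the path \<open>1, a, a\<^sup>2\<close> backtracks at \<open>a\<close> by less than half the length of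
  \<open>a\<close>. Since \<open>a\<close> and \<open>a\<^sup>n\<close> then share more than that length, the bound on the backtracking at the
  identity between \<open>a\<inverse>\<close> and \<open>a\<close> passes to \<open>a\<inverse>\<close> and \<open>a\<^sup>n\<close> at the cost of a single \<open>\<delta>\<close>, which does not
  accumulate in the induction.
\<close>

lemma loxodromic_axis_aux:
  assumes a [simp]: "a \<in> carrier G" and big: "len (a \<otimes> a) > len a + 3 * \<delta>"
  shows "gp \<one> (inv a) (a [^] (n::nat)) \<le> gp \<one> (inv a) a + \<delta>"
proof -
  have D: "2 * gp \<one> (inv a) a = 2 * len a - len (a \<otimes> a)"
    by (simp add: gromov_product_def len_inv) (simp add: d_def)
  show ?thesis
  proof (induction n)
    case 0
    then show ?case using gp_nonneg[of \<one> "inv a" a] delta_nonneg gp_le[of \<one> \<one> "inv a"] gp_sym[of \<one> "inv a" \<one>] by (simp add: len_one)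
  next
    case (Suc n)
    show ?case
    proof (cases n)
      case 0
      then show ?thesis using delta_nonneg by simp
    next
      case (Suc m)
      have "gp a \<one> (a [^] Suc n) = gp \<one> (inv a) (a [^] n)"
        using gp_translate[of a \<one> "inv a" "a [^] n"] nat_pow_Suc2[of a n] by simp
      then have "gp \<one> a (a [^] Suc n) = len a - gp \<one> (inv a) (a [^] n)"
        using gp_swap[of a \<one> "a [^] Suc n"] by simp
      then have "gp \<one> (a [^] Suc n) a > gp \<one> (inv a) a + \<delta>"
        using Suc.IH D big delta_nonneg gp_sym[of a "a [^] Suc n" \<one>] by simp
      then show ?thesis
        by (intro gp_min_le[of _ _ _ a]) auto
    qed
  qed
qed

lemma loxodromicI:
  assumes a [simp]: "a \<in> carrier G" and big: "len (a \<otimes> a) > len a + 3 * \<delta>"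
  shows "loxodromic a"
proof -
  define D where "D = gp \<one> (inv a) a"
  have D: "2 * D = 2 * len a - len (a \<otimes> a)"
    by (simp add: D_def gromov_product_def len_inv) (simp add: d_def)
  have "D \<ge> 0" by (simp add: D_def gp_nonneg)
  have fwd: "gp \<one> (inv a) (a [^] n) \<le> D + \<delta>" for n :: nat
    unfolding D_def by (rule loxodromic_axis_aux[OF a big])
  have bwd: "gp \<one> (inv a [^] n) a \<le> D + \<delta>" for n :: nat
  proof -
    have "len (inv a \<otimes> inv a) > len (inv a) + 3 * \<delta>"
      using big len_inv[of "a \<otimes> a"] by (simp add: len_inv inv_mult_group)
    then show ?thesis
      using loxodromic_axis_aux[of "inv a" n] gp_sym[of "inv a [^] n" a \<one>] gp_sym[of "inv a" a \<one>] by (simp add: D_def)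
  qed
  have nat: "gp \<one> (inv a [^] i) (a [^] j) \<le> D + 2 * \<delta>" for i j :: nat
  proof (cases j)
    case 0
    then show ?thesis
      using gp_le[of \<one> \<one> "inv a [^] i"] gp_sym[of \<one> "inv a [^] i" \<one>] \<open>D \<ge> 0\<close> delta_nonneg by (simp add: len_one)
  next
    case (Suc m)
    have "gp a \<one> (a [^] j) = gp \<one> (inv a) (a [^] m)"
      using gp_translate[of a \<one> "inv a" "a [^] m"] nat_pow_Suc2[of a m] Suc by simp
    then have "gp \<one> a (a [^] j) = len a - gp \<one> (inv a) (a [^] m)"
      using gp_swap[of a \<one> "a [^] j"] by simp
    then have "gp \<one> (a [^] j) a > D + \<delta> + \<delta>"
      using fwd[of m] D big delta_nonneg gp_sym[of a "a [^] j" \<one>] by simp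
    then have "gp \<one> (inv a [^] i) (a [^] j) \<le> D + \<delta> + \<delta>"
      using gp_min_le[of \<one> "inv a [^] i" "a [^] j" a "D + \<delta>"] bwd by simp
    then show ?thesis by simp
  qed
  have gpi: "gp \<one> (a [^] i) (a [^] j) \<le> D + 2 * \<delta>" if "i * j \<le> 0" for i j :: int
  proof -
    have neg: "a [^] i = inv a [^] nat (- i)" if "i \<le> 0" for i :: int
      using that by (simp add: pow_nat int_pow_inv int_pow_neg)
    have pos: "a [^] i = a [^] nat i" if "i \<ge> 0" for i :: int
      using that by (simp add: pow_nat)
    from that consider "i \<le> 0" "j \<ge> 0" | "i \<ge> 0" "j \<le> 0"
      by (auto simp: mult_le_0_iff)
    then show ?thesis
    proof cases
      case 1
      show ?thesis
        unfolding neg[OF \<open>i \<le> 0\<close>] pos[OF \<open>j \<ge> 0\<close>] by (rule nat)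
    next
      case 2
      have "gp \<one> (a [^] j) (a [^] i) \<le> D + 2 * \<delta>"
        unfolding neg[OF \<open>j \<le> 0\<close>] pos[OF \<open>i \<ge> 0\<close>] by (rule nat)
      then show ?thesis
        using gp_sym[of "a [^] i" "a [^] j" \<one>] by simp
    qed
  qed
  define \<kappa> where "\<kappa> = len (a \<otimes> a) - len a - 2 * \<delta>"
  have "\<kappa> > 0" using big delta_nonneg by (simp add: \<kappa>_def)
  have grow: "len (a [^] n) \<ge> \<kappa> * real n" for n :: nat
  proof (induction n)
    case 0
    then show ?case by (simp add: len_one)
  next
    case (Suc n)
    have "d (inv a) (a [^] n) = len (a [^] Suc n)"
      using d_translate[of a "inv a" "a [^] n"] nat_pow_Suc2[of a n] by simp
    then have "len (a [^] Suc n) \<ge> len (a [^] n) + \<kappa>"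
      using fwd[of n] D by (simp add: gromov_product_def \<kappa>_def len_inv)
    then show ?case using Suc by (simp add: algebra_simps)
  qed
  have "\<exists>c. \<forall>i j::int. i * j \<le> 0 \<longrightarrow> gp \<one> (a [^] i) (a [^] j) \<le> c"
    using gpi by blast
  moreover have "\<exists>\<kappa>>0. \<exists>e. \<forall>n::nat. len (a [^] n) \<ge> \<kappa> * real n - e"
    using grow \<open>\<kappa> > 0\<close> by (intro exI[of _ \<kappa>] conjI exI[of _ 0]) simp_all
  ultimately show ?thesis unfolding loxodromic_def using a by simp
qed

section \<open>Elements of infinite order have loxodromic powers\<close>

text \<open>
  Let \<open>p\<close> be a point far from both ends of a geodesic from \<open>1\<close> to \<open>b\<close>. As \<open>s\<close> commutes with \<open>b\<close>, it
  moves both ends by at most \<open>R\<close>, so near \<open>p\<close> it acts almost as a translation along the geodesic,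
  and \<open>s\<^sup>2\<close> as a translation by twice the distance. If moving \<open>p\<close> by \<open>s\<^sup>2\<close> is hardly longer than moving
  it by \<open>s\<close>, then the translation distance must be small.
\<close>

lemma translation_short:
  assumes [simp]: "s \<in> carrier G" "b \<in> carrier G" "p \<in> carrier G"
    and comm: "s \<otimes> b = b \<otimes> s" and p: "gp p \<one> b = 0"
    and s: "len s \<le> R" and far: "len p \<ge> 3 * R + 20 * \<delta> + 1" "d p b \<ge> 3 * R + 20 * \<delta> + 1"
    and slow: "d p (s \<otimes> (s \<otimes> p)) \<le> d p (s \<otimes> p) + 3 * \<delta>"
  shows "d p (s \<otimes> p) \<le> 17 * \<delta>"
proof -
  define q r where "q = s \<otimes> p" and "r = s \<otimes> q"
  have [simp]: "q \<in> carrier G" "r \<in> carrier G" by (simp_all add: q_def r_def)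
  have "R \<ge> 0" using s len_nonneg[of s] by simp
  note pos = \<open>R \<ge> 0\<close> delta_nonneg
  have sq: "d s q = len p" "d q s = len p"
    using d_translate[of s \<one> p] d_sym[of s q] by (simp_all add: q_def)
  have sr: "d s r = len q"
    using d_translate[of s \<one> q] by (simp add: r_def)
  have qr: "d q r = d p q" "d r q = d p q"
    using d_translate[of s p q] d_sym[of q r] by (simp_all add: q_def r_def)
  have qsb: "d q (s \<otimes> b) = d p b" by (simp add: q_def)
  have bsb: "d b (s \<otimes> b) = len s" by (simp add: comm)
  have Qlow: "len q \<ge> len p - R" "len q \<le> len p + R"
    using d_triangle[of s \<one> q] d_triangle[of \<one> s q] sq s by simp_all
  have "gp q s (s \<otimes> b) = 0"
    using gp_translate[of s p \<one> b] p by (simp add: q_def)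
  moreover have "gp q b (s \<otimes> b) > 0 + \<delta>"
  proof -
    have "d b q \<ge> d p b - R"
      using d_triangle[of q b "s \<otimes> b"] qsb bsb s d_sym[of q b] by simp
    then show ?thesis
      using far pos s bsb qsb d_sym[of q "s \<otimes> b"] unfolding gromov_product_def by simp
  qed
  ultimately have "gp q s b \<le> \<delta>"
    using gp_min_le[of q s b "s \<otimes> b" 0] by simp
  then have "gp q b s \<le> \<delta>" using gp_sym[of s b q] by simp
  have q1s: "gp q \<one> s \<ge> R + 9 * \<delta> + 1"
    using far pos s sq Qlow unfolding gromov_product_def by simp
  moreover have "gp q b \<one> \<le> \<delta> + \<delta>"
    using gp_min_le[of q b \<one> s \<delta>] q1s far pos \<open>gp q b s \<le> \<delta>\<close> sq Qlow s
    unfolding gromov_product_def by simp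
  ultimately have "d p q \<le> \<bar>d \<one> p - d \<one> q\<bar> + 2 * (2 * \<delta>) + 2 * \<delta>"
    using p pos gp_sym[of b \<one> q] by (intro close_if_between[where y = b]) auto
  then have T: "d p q \<le> \<bar>len p - len q\<bar> + 6 * \<delta>" by simp
  have "gp q s r \<le> d p q" using gp_le[of q r s] gp_sym[of s r q] qr by simp
  then have small: "gp q s r \<le> R + 6 * \<delta>" using T Qlow by linarith
  \<comment> \<open>Gromov products at \<open>q\<close> compare how far \<open>r\<close> lies beyond \<open>q\<close> as seen from \<open>1\<close> and from \<open>s\<close>:
    since \<open>1\<close> and \<open>s\<close> are close to each other and far from \<open>q\<close>, the answers agree up to \<open>2 \<delta>\<close>.\<close>
  have "gp q \<one> r \<ge> gp q s r - \<delta>"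
    using small q1s pos by (intro gp_min_ge[of _ _ s]) auto
  moreover have "gp q s r \<ge> gp q \<one> r - \<delta>"
  proof (rule ccontr)
    assume *: "\<not> gp q s r \<ge> gp q \<one> r - \<delta>"
    moreover have "gp q s \<one> \<ge> R + 9 * \<delta> + 1" using q1s gp_sym[of \<one> s q] by simp
    ultimately show False using gp_min[of q s \<one> r] small pos by simp
  qed
  ultimately have "\<bar>(len r - len q) - (len q - len p)\<bar> \<le> 2 * \<delta>"
    using sq sr qr d_sym[of q s] unfolding gromov_product_def
    by (simp add: abs_le_iff field_simps)
  moreover have "\<bar>len r - len p\<bar> \<le> d p r"
    using d_triangle[of \<one> p r] d_triangle[of \<one> r p] d_sym[of p r] by simp
  moreover have "d p r \<le> d p q + 3 * \<delta>"
    using slow by (simp add: q_def r_def)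
  ultimately have "d p q \<le> 17 * \<delta>" using T by linarith
  then show ?thesis by (simp add: q_def)
qed

lemma len_nat_pow: "a \<in> carrier G \<Longrightarrow> len (a [^] (n::nat)) \<le> real n * len a"
proof (induction n)
  case (Suc n)
  then show ?case using len_mult[of "a [^] n" a] by (simp add: algebra_simps)
qed (simp add: len_one)

lemma inj_pow_if_infinite_order:
  assumes "a \<in> carrier G" "\<And>n::nat. n > 0 \<Longrightarrow> a [^] n \<noteq> \<one>"
  shows "inj (\<lambda>n::nat. a [^] n)"
proof (rule linorder_injI)
  fix m n :: nat assume "m < n"
  then have "a [^] (n - m) \<noteq> \<one>" using assms by simp
  then show "a [^] m \<noteq> a [^] n" using pow_eq_div2[of a n m] assms(1) by metis
qed

text \<open>
  Otherwise no conjugate of a power of \<open>a\<close> satisfies the criterion \<open>loxodromicI\<close>, and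
  \<open>translation_short\<close> yields a single point \<open>p\<close> that is moved by at most \<open>17 \<delta>\<close> by more powers of
  \<open>a\<close> than the ball of this radius has elements. So two powers of \<open>a\<close> coincide.
\<close>

lemma exists_loxodromic_power:
  assumes a [simp]: "a \<in> carrier G" and inf: "\<And>n::nat. n > 0 \<Longrightarrow> a [^] n \<noteq> \<one>"
  shows "\<exists>j p. (j::nat) > 0 \<and> p \<in> carrier G \<and> loxodromic (inv p \<otimes> a [^] j \<otimes> p)"
proof (rule ccontr)
  assume no: "\<not> ?thesis"
  \<comment> \<open>\<open>M\<close> is chosen so that \<open>M + 1\<close> distinct elements do not fit into the ball \<open>B\<close>; \<open>R\<close> bounds the
    lengths of the first \<open>M\<close> powers, and \<open>K\<close> is the distance from the ends in \<open>translation_short\<close>.\<close>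
  define B where "B = {x \<in> carrier G. len x \<le> 17 * \<delta>}"
  define M where "M = card B"
  define R where "R = real M * len a"
  define K where "K = 3 * R + 20 * \<delta> + 1"
  have inj: "inj (\<lambda>n::nat. a [^] n)" using inf by (rule inj_pow_if_infinite_order[OF a])
  have slow: "d p (a [^] j \<otimes> (a [^] j \<otimes> p)) \<le> d p (a [^] j \<otimes> p) + 3 * \<delta>"
    if "j > 0" and [simp]: "p \<in> carrier G" for j :: nat and p
  proof -
    have "\<not> loxodromic (inv p \<otimes> a [^] j \<otimes> p)" using no that by blast
    then have "\<not> len ((inv p \<otimes> a [^] j \<otimes> p) \<otimes> (inv p \<otimes> a [^] j \<otimes> p)) > len (inv p \<otimes> a [^] j \<otimes> p) + 3 * \<delta>"
      using loxodromicI[of "inv p \<otimes> a [^] j \<otimes> p"] by auto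
    moreover have "(inv p \<otimes> a [^] j \<otimes> p) \<otimes> (inv p \<otimes> a [^] j \<otimes> p) = inv p \<otimes> (a [^] j \<otimes> (a [^] j \<otimes> p))"
      by (simp add: m_assoc mult_inv_cancel)
    ultimately show ?thesis by (simp add: d_def m_assoc)
  qed
  obtain L :: nat where L: "real L \<ge> K" using real_arch_simple by blast
  obtain n :: nat where n: "len (a [^] n) \<ge> real L + K"
  proof -
    have "infinite (range (\<lambda>n::nat. a [^] n))" using inj by (simp add: finite_image_iff)
    then have "\<not> range (\<lambda>n::nat. a [^] n) \<subseteq> {x \<in> carrier G. len x \<le> real L + K}"
      using finite_ball finite_subset by blast
    then obtain n :: nat where "len (a [^] n) > real L + K"
      by (auto simp: image_subset_iff not_le)
    then show thesis using that[of n] by simp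
  qed
  define b where "b = a [^] n"
  have [simp]: "b \<in> carrier G" by (simp add: b_def)
  have "K \<ge> 0" by (simp add: K_def R_def len_nonneg delta_nonneg)
  then obtain p where p [simp]: "p \<in> carrier G" and "len p = real L" "len (inv p \<otimes> b) = len b - real L"
    using geodesic_point[of b L] n by (auto simp: b_def)
  then have pb: "len p = real L" "d p b = len b - real L" by (simp_all add: d_def)
  have short: "d p (a [^] j \<otimes> p) \<le> 17 * \<delta>" if "j \<le> M" for j :: nat
  proof (cases "j = 0")
    case True
    then show ?thesis by (simp add: delta_nonneg)
  next
    case False
    show ?thesis
    proof (rule translation_short[of _ b])
      show "a [^] j \<otimes> b = b \<otimes> a [^] j" by (simp add: b_def nat_pow_mult add.commute)
      show "gp p \<one> b = 0" using pb d_sym[of b p] unfolding gromov_product_def by simp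
      show "len (a [^] j) \<le> R"
        unfolding R_def using len_nat_pow[of a j] that len_nonneg[of a]
        by (meson a mult_right_mono of_nat_le_iff order_trans)
      show "len p \<ge> 3 * R + 20 * \<delta> + 1" "d p b \<ge> 3 * R + 20 * \<delta> + 1"
        using pb L n by (simp_all add: K_def b_def)
    qed (use slow False in auto)
  qed
  have "(\<lambda>j::nat. inv p \<otimes> (a [^] j \<otimes> p)) ` {..M} \<subseteq> B"
    using short by (auto simp: B_def d_def)
  moreover have "inj_on (\<lambda>j::nat. inv p \<otimes> (a [^] j \<otimes> p)) {..M}"
    using inj by (auto simp: inj_on_def)
  moreover have "finite B" unfolding B_def by (rule finite_ball)
  ultimately have "card {..M} \<le> M"
    unfolding M_def by (metis card_inj_on_le)
  then show False by simp
qed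

section \<open>Axes of loxodromic elements and elementary closures\<close>

lemma loxodromic_carrier [simp]: "loxodromic a \<Longrightarrow> a \<in> carrier G"
  by (simp add: loxodromic_def)

lemma loxodromic_between:
  assumes "loxodromic a"
  obtains c where "c \<ge> 0" "\<And>i k m::int. (i - k) * (m - k) \<le> 0 \<Longrightarrow> gp (a [^] k) (a [^] i) (a [^] m) \<le> c"
proof -
  have [simp]: "a \<in> carrier G" using assms by simp
  obtain c where c: "\<And>i j::int. i * j \<le> 0 \<Longrightarrow> gp \<one> (a [^] i) (a [^] j) \<le> c"
    using assms unfolding loxodromic_def by blast
  have "gp (a [^] k) (a [^] i) (a [^] m) \<le> c" if "(i - k) * (m - k) \<le> 0" for i k m :: int
    using c[OF that] gp_translate[of "a [^] k" \<one> "a [^] (i - k)" "a [^] (m - k)"]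
    by (simp flip: int_pow_mult)
  moreover have "c \<ge> 0"
    using c[of 0 0] gp_nonneg[of \<one> \<one> \<one>] by simp
  ultimately show thesis using that by blast
qed

lemma loxodromic_growth:
  assumes "loxodromic a"
  obtains \<kappa> e where "\<kappa> > 0" "\<And>i::int. len (a [^] i) \<ge> \<kappa> * real_of_int \<bar>i\<bar> - e"
proof -
  have [simp]: "a \<in> carrier G" using assms by simp
  obtain \<kappa> e where \<kappa>: "\<kappa> > 0" "\<And>n::nat. len (a [^] n) \<ge> \<kappa> * real n - e"
    using assms unfolding loxodromic_def by blast
  have "len (a [^] i) \<ge> \<kappa> * real_of_int \<bar>i\<bar> - e" for i :: int
    using \<kappa>(2)[of "nat \<bar>i\<bar>"] by (cases "i \<ge> 0") (simp_all add: pow_nat int_pow_neg len_inv)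
  with \<kappa>(1) that show thesis by blast
qed

lemma loxodromic_pow_large:
  assumes "loxodromic a"
  shows "\<exists>n::nat. \<forall>m::int. \<bar>m\<bar> \<ge> int n \<longrightarrow> len (a [^] m) \<ge> r"
proof -
  obtain \<kappa> e where \<kappa>: "\<kappa> > 0" "\<And>i::int. len (a [^] i) \<ge> \<kappa> * real_of_int \<bar>i\<bar> - e"
    using loxodromic_growth[OF assms] by blast
  obtain n :: nat where n: "(r + e) / \<kappa> \<le> real n" using real_arch_simple by blast
  have "len (a [^] m) \<ge> r" if "\<bar>m\<bar> \<ge> int n" for m :: int
  proof -
    from that have "real n \<le> real_of_int \<bar>m\<bar>" by linarith
    with n have "(r + e) / \<kappa> \<le> real_of_int \<bar>m\<bar>" by linarith
    then have "r + e \<le> \<kappa> * real_of_int \<bar>m\<bar>" using \<kappa>(1) by (simp add: pos_divide_le_eq mult.commute)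
    then show ?thesis using \<kappa>(2)[of m] by linarith
  qed
  then show ?thesis by blast
qed

lemma loxodromic_pow_eq_one:
  assumes "loxodromic a" "a [^] (i::int) = \<one>"
  shows "i = 0"
proof (rule ccontr)
  assume "i \<noteq> 0"
  obtain n :: nat where n: "\<And>m::int. \<bar>m\<bar> \<ge> int n \<Longrightarrow> len (a [^] m) \<ge> 1"
    using loxodromic_pow_large[OF assms(1), of 1] by blast
  have "\<bar>i * int n\<bar> \<ge> int n"
    using mult_right_mono[of 1 "\<bar>i\<bar>" "int n"] \<open>i \<noteq> 0\<close> by (simp add: abs_mult)
  then have "len (a [^] (i * int n)) \<ge> 1" by (rule n)
  moreover have "a [^] (i * int n) = (a [^] i) [^] int n"
    using assms(1) by (simp add: int_pow_pow)
  ultimately show False by (simp add: assms(2) len_one)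
qed

text \<open>
  The commensurator of the cyclic group generated by \<open>a\<close>. For loxodromic \<open>a\<close> it is the
  maximal virtually cyclic subgroup that contains \<open>a\<close>.
\<close>

definition elementary_closure :: "'a \<Rightarrow> 'a set" where
  "elementary_closure a =
     {h \<in> carrier G. \<exists>(p::int) (q::int). p \<noteq> 0 \<and> q \<noteq> 0 \<and> h \<otimes> a [^] q = a [^] p \<otimes> h}"

text \<open>
  If the two rays shared arbitrarily long segments, then each of the first powers of \<open>a\<^sup>\<epsilon>\<close> would be
  close to some point of the ray starting at \<open>h\<close>, within a distance \<open>C\<close> that does not depend on how
  many powers are considered. Two of the resulting short connecting elements coincide, and this
  is a relation that puts \<open>h\<close> into the elementary closure.
\<close>

lemma bounded_divergence:
  fixes \<epsilon> \<epsilon>' :: int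
  assumes lox: "loxodromic a" and h [simp]: "h \<in> carrier G" and nE: "h \<notin> elementary_closure a"
    and signs: "\<bar>\<epsilon>\<bar> = 1" "\<bar>\<epsilon>'\<bar> = 1"
  shows "\<exists>D. \<forall>m::nat. gp \<one> (a [^] (\<epsilon> * int m)) (h \<otimes> a [^] (\<epsilon>' * int m)) \<le> D"
proof (rule ccontr)
  assume "\<not> ?thesis"
  then have unb: "\<exists>m::nat. gp \<one> (a [^] (\<epsilon> * int m)) (h \<otimes> a [^] (\<epsilon>' * int m)) > D" for D
    by (metis not_le)
  have [simp]: "a \<in> carrier G" using lox by simp
  obtain c where "c \<ge> 0" and c: "\<And>i k m::int. (i - k) * (m - k) \<le> 0 \<Longrightarrow> gp (a [^] k) (a [^] i) (a [^] m) \<le> c"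
    using loxodromic_between[OF lox] by blast
  define C where "C = 2 * c + 3 * len a + 5 * len h + 4 * \<delta>"
  define B where "B = {x \<in> carrier G. len x \<le> C}"
  define M where "M = card B"
  define D where "D = real M * len a"
  have len_pow: "len (a [^] (\<eta> * int i)) \<le> real i * len a" if "\<bar>\<eta>\<bar> = 1" for \<eta> :: int and i
  proof -
    from that have "\<eta> = 1 \<or> \<eta> = -1" by auto
    then show ?thesis
      using len_nat_pow[of a i] by (auto simp: int_pow_neg int_pow_int len_inv)
  qed
  obtain m :: nat where m: "gp \<one> (a [^] (\<epsilon> * int m)) (h \<otimes> a [^] (\<epsilon>' * int m)) > D"
    using unb by blast
  define P Q where "P = a [^] (\<epsilon> * int m)" and "Q = h \<otimes> a [^] (\<epsilon>' * int m)"
  have [simp]: "P \<in> carrier G" "Q \<in> carrier G" by (simp_all add: P_def Q_def)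
  have gpPQ: "gp \<one> P Q > D" using m by (simp add: P_def Q_def)
  have "len P > D" "len Q > D"
    using gpPQ gp_le[of \<one> P Q] gp_le[of \<one> Q P] gp_sym[of P Q \<one>] by simp_all
  have "M < m"
  proof (rule ccontr)
    assume "\<not> M < m"
    then have "real m * len a \<le> D"
      unfolding D_def by (intro mult_right_mono) (simp_all add: len_nonneg)
    then show False using \<open>len P > D\<close> len_pow[OF signs(1), of m] by (simp add: P_def)
  qed
  have same_side: "(0 - \<eta> * int i) * (\<eta> * int m - \<eta> * int i) \<le> 0" if "\<bar>\<eta>\<bar> = 1" "i \<le> m" for \<eta> :: int and i
  proof -
    from that(1) have "\<eta> = 1 \<or> \<eta> = -1" by auto
    then show ?thesis using that(2) by (auto simp: mult_le_0_iff)
  qed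
  have "\<exists>j::nat. d (a [^] (\<epsilon> * int i)) (h \<otimes> a [^] (\<epsilon>' * int j)) \<le> C" if "i \<le> M" for i :: nat
  proof -
    define x where "x = a [^] (\<epsilon> * int i)"
    have [simp]: "x \<in> carrier G" by (simp add: x_def)
    have "len x \<le> D"
    proof -
      have "real i * len a \<le> D"
        using that unfolding D_def by (intro mult_right_mono) (simp_all add: len_nonneg)
      then show ?thesis using len_pow[OF signs(1), of i] unfolding x_def by linarith
    qed
    define f where "f = (\<lambda>j::nat. len (h \<otimes> a [^] (\<epsilon>' * int j)))"
    \<comment> \<open>Find a point on the ray from \<open>h\<close> at about the same distance from \<open>1\<close> as \<open>x\<close>.\<close>
    have "\<exists>j\<le>m. \<bar>f j - len x\<bar> \<le> len a + len h"
    proof (rule discrete_intermediate_value)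
      show "f 0 \<le> len x + len h" by (simp add: f_def len_nonneg)
      show "len x \<le> f m + len h"
        using \<open>len Q > D\<close> \<open>len x \<le> D\<close> len_nonneg[of h] by (simp add: f_def Q_def)
      show "\<bar>f (Suc j) - f j\<bar> \<le> len a" for j
      proof -
        define y z where "y = h \<otimes> a [^] (\<epsilon>' * int j)" and "z = a [^] (\<epsilon>' * int 1)"
        have [simp]: "y \<in> carrier G" "z \<in> carrier G" by (simp_all add: y_def z_def)
        have "h \<otimes> a [^] (\<epsilon>' * int (Suc j)) = y \<otimes> z"
          by (simp add: y_def z_def m_assoc algebra_simps flip: int_pow_mult)
        then have "f (Suc j) = len (y \<otimes> z)" "f j = len y" by (simp_all only: f_def y_def)
        moreover have "\<bar>len (y \<otimes> z) - len y\<bar> \<le> len z"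
          using len_mult[of y z] len_mult[of "y \<otimes> z" "inv z"]
          by (simp add: len_inv mult_inv_cancel abs_le_iff)
        moreover have "len z \<le> len a"
          using len_pow[OF signs(2), of 1] unfolding z_def by simp
        ultimately show ?thesis by simp
      qed
    qed (simp_all add: len_nonneg)
    then obtain j where j: "j \<le> m" "\<bar>f j - len x\<bar> \<le> len a + len h" by blast
    define y where "y = h \<otimes> a [^] (\<epsilon>' * int j)"
    have [simp]: "y \<in> carrier G" by (simp add: y_def)
    have fj: "f j = len y" by (simp add: f_def y_def)
    have "gp x \<one> P \<le> c"
      unfolding x_def P_def using c[OF same_side[OF signs(1), of i]] that \<open>M < m\<close> by simp
    then have xP: "gp \<one> x P \<ge> len x - c" using gp_swap[of x \<one> P] by simp
    have "gp y h Q = gp (a [^] (\<epsilon>' * int j)) \<one> (a [^] (\<epsilon>' * int m))"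
      unfolding y_def Q_def using gp_translate[of h "a [^] (\<epsilon>' * int j)" \<one> "a [^] (\<epsilon>' * int m)"] by simp
    also have "\<dots> \<le> c" using c[OF same_side[OF signs(2) j(1)]] by simp
    finally have "gp y \<one> Q \<le> c + len h" using gp_move_point[of y \<one> h Q] by simp
    then have yQ: "gp \<one> Q y \<ge> len y - c - len h" using gp_swap[of y \<one> Q] gp_sym[of y Q \<one>] by simp
    have "gp \<one> x Q \<ge> len x - c - \<delta>"
      using xP gpPQ \<open>len x \<le> D\<close> \<open>c \<ge> 0\<close> by - (rule gp_min_ge[of _ _ P], auto)
    then have "gp \<one> x y \<ge> len x - c - len a - 2 * len h - \<delta> - \<delta>"
      using yQ j(2) len_nonneg[of h] len_nonneg[of a] delta_nonneg unfolding fj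
      by - (rule gp_min_ge[of _ _ Q], auto simp: abs_le_iff)
    then have "d x y \<le> C"
      using j(2) d_sym[of x y] unfolding fj gromov_product_def C_def by (simp add: abs_le_iff)
    then show ?thesis unfolding x_def y_def by blast
  qed
  then obtain \<sigma> :: "nat \<Rightarrow> nat"
    where \<sigma>: "\<And>i. i \<le> M \<Longrightarrow> d (a [^] (\<epsilon> * int i)) (h \<otimes> a [^] (\<epsilon>' * int (\<sigma> i))) \<le> C"
    by metis
  define F where "F = (\<lambda>i. inv (a [^] (\<epsilon> * int i)) \<otimes> (h \<otimes> a [^] (\<epsilon>' * int (\<sigma> i))))"
  have "F ` {..M} \<subseteq> B" using \<sigma> by (auto simp: F_def B_def d_def)
  moreover have "finite B" unfolding B_def by (rule finite_ball)
  ultimately have "\<not> inj_on F {..M}"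
    using card_inj_on_le[of F "{..M}" B] by (auto simp: M_def)
  then obtain i j where ij: "i \<noteq> j" "F i = F j" by (auto simp: inj_on_def)
  define p q where "p = \<epsilon> * int j - \<epsilon> * int i" and "q = \<epsilon>' * int (\<sigma> j) - \<epsilon>' * int (\<sigma> i)"
  have "p \<noteq> 0" using ij(1) signs by (auto simp: p_def)
  have "h \<otimes> a [^] q = h \<otimes> a [^] (\<epsilon>' * int (\<sigma> j)) \<otimes> inv (a [^] (\<epsilon>' * int (\<sigma> i)))"
    by (simp add: q_def int_pow_diff m_assoc)
  also have "h \<otimes> a [^] (\<epsilon>' * int (\<sigma> j)) = a [^] (\<epsilon> * int j) \<otimes> F j"
    by (simp add: F_def mult_inv_cancel)
  also have "F j = F i" using ij by simp
  also have "a [^] (\<epsilon> * int j) \<otimes> F i \<otimes> inv (a [^] (\<epsilon>' * int (\<sigma> i))) = a [^] p \<otimes> h"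
    by (simp add: F_def p_def int_pow_diff m_assoc)
  finally have rel: "h \<otimes> a [^] q = a [^] p \<otimes> h" .
  have "q \<noteq> 0"
  proof
    assume "q = 0"
    then have "a [^] p \<otimes> h = h" using rel by simp
    then have "a [^] p = \<one>" using r_cancel_one[of h "a [^] p"] by simp
    with \<open>p \<noteq> 0\<close> loxodromic_pow_eq_one[OF lox] show False by blast
  qed
  have "h \<in> elementary_closure a"
    unfolding elementary_closure_def using h rel \<open>p \<noteq> 0\<close> \<open>q \<noteq> 0\<close>
    by (intro CollectI conjI exI[of _ p] exI[of _ q])
  with nE show False by simp
qed

lemma intertwine_int_pow:
  assumes [simp]: "h \<in> carrier G" "x \<in> carrier G" "y \<in> carrier G" and rel: "h \<otimes> x = y \<otimes> h"
  shows "h \<otimes> x [^] (n::int) = y [^] n \<otimes> h"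
proof -
  have nat: "h \<otimes> x [^] m = y [^] m \<otimes> h" for m :: nat
  proof (induction m)
    case (Suc m)
    have "h \<otimes> x [^] Suc m = (h \<otimes> x [^] m) \<otimes> x" by (simp add: m_assoc)
    also have "\<dots> = y [^] m \<otimes> (h \<otimes> x)" by (simp add: Suc m_assoc)
    also have "\<dots> = y [^] Suc m \<otimes> h" by (simp add: rel m_assoc)
    finally show ?case .
  qed simp
  have "h \<otimes> inv (x [^] m) = inv (y [^] m) \<otimes> h" for m :: nat
  proof -
    have "h \<otimes> inv (x [^] m) = inv (y [^] m) \<otimes> (y [^] m \<otimes> h) \<otimes> inv (x [^] m)"
      by (simp add: mult_inv_cancel)
    also have "\<dots> = inv (y [^] m) \<otimes> h"
      by (simp add: nat[symmetric] m_assoc)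
    finally show ?thesis .
  qed
  with nat show ?thesis
    by (cases n rule: int_cases2) (simp_all add: int_pow_int int_pow_neg_int)
qed

lemma conj_int_pow:
  assumes [simp]: "s \<in> carrier G" "x \<in> carrier G"
  shows "(s \<otimes> x \<otimes> inv s) [^] (n::int) = s \<otimes> x [^] n \<otimes> inv s"
proof -
  have "s \<otimes> x [^] n = (s \<otimes> x \<otimes> inv s) [^] n \<otimes> s"
    by (rule intertwine_int_pow) (simp_all add: mult_inv_cancel)
  then show ?thesis by (simp add: mult_inv_cancel)
qed

lemma loxodromic_conj:
  assumes lox: "loxodromic a" and s [simp]: "s \<in> carrier G"
  shows "loxodromic (s \<otimes> a \<otimes> inv s)"
proof -
  have [simp]: "a \<in> carrier G" using lox by simp
  let ?b = "s \<otimes> a \<otimes> inv s"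
  obtain c where c: "\<And>i j::int. i * j \<le> 0 \<Longrightarrow> gp \<one> (a [^] i) (a [^] j) \<le> c"
    using lox unfolding loxodromic_def by blast
  obtain \<kappa> e where \<kappa>: "\<kappa> > 0" "\<And>n::nat. len (a [^] n) \<ge> \<kappa> * real n - e"
    using lox unfolding loxodromic_def by blast
  have near: "gp \<one> (s \<otimes> x \<otimes> inv s) (s \<otimes> y \<otimes> inv s) \<le> gp \<one> x y + 3 * len s"
    if [simp]: "x \<in> carrier G" "y \<in> carrier G" for x y
  proof -
    let ?X = "s \<otimes> x \<otimes> inv s" and ?Y = "s \<otimes> y \<otimes> inv s"
    have "d ?X (s \<otimes> x) = len s" "d ?Y (s \<otimes> y) = len s"
      using d_sym[of ?X "s \<otimes> x"] d_sym[of ?Y "s \<otimes> y"] by (simp_all add: len_inv)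
    moreover have "gp s (s \<otimes> x) (s \<otimes> y) = gp \<one> x y"
      using gp_translate[of s \<one> x y] by simp
    ultimately show ?thesis
      using gp_move_base[of \<one> s ?X ?Y] gp_move_point[of s ?X "s \<otimes> x" ?Y]
        gp_move_point[of s ?Y "s \<otimes> y" "s \<otimes> x"] gp_sym[of "s \<otimes> x" ?Y s] gp_sym[of "s \<otimes> x" "s \<otimes> y" s]
      by simp
  qed
  have "gp \<one> (?b [^] i) (?b [^] j) \<le> c + 3 * len s" if "i * j \<le> 0" for i j :: int
    using c[OF that] near[of "a [^] i" "a [^] j"] by (simp add: conj_int_pow)
  moreover have "len (?b [^] n) \<ge> \<kappa> * real n - (e + 2 * len s)" for n :: nat
  proof -
    have "len (x) \<le> len (s \<otimes> x \<otimes> inv s) + 2 * len s" if [simp]: "x \<in> carrier G" for x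
      using len_mult[of "inv s" "s \<otimes> x"] len_mult[of "s \<otimes> x \<otimes> inv s" "s"] len_inv[OF s]
      by (simp add: mult_inv_cancel)
    from this[of "a [^] n"] show ?thesis
      using \<kappa>(2)[of n] conj_int_pow[of s a "int n"] by (simp add: int_pow_int)
  qed
  ultimately show ?thesis
    unfolding loxodromic_def using \<kappa>(1) by (metis s \<open>a \<in> carrier G\<close> inv_closed m_closed)
qed

lemma elementary_closure_carrier: "h \<in> elementary_closure a \<Longrightarrow> h \<in> carrier G"
  by (simp add: elementary_closure_def)

lemma elementary_closure_mult:
  assumes [simp]: "a \<in> carrier G" and h: "h \<in> elementary_closure a" and h': "h' \<in> elementary_closure a"
  shows "h \<otimes> h' \<in> elementary_closure a"
proof -
  have [simp]: "h \<in> carrier G" "h' \<in> carrier G" using h h' by (simp_all add: elementary_closure_carrier)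
  obtain p q :: int where pq: "p \<noteq> 0" "q \<noteq> 0" "h \<otimes> a [^] q = a [^] p \<otimes> h"
    using h unfolding elementary_closure_def by blast
  obtain p' q' :: int where pq': "p' \<noteq> 0" "q' \<noteq> 0" "h' \<otimes> a [^] q' = a [^] p' \<otimes> h'"
    using h' unfolding elementary_closure_def by blast
  have "(h \<otimes> h') \<otimes> a [^] (q' * q) = h \<otimes> (h' \<otimes> (a [^] q') [^] q)"
    by (simp add: m_assoc int_pow_pow)
  also have "\<dots> = h \<otimes> ((a [^] p') [^] q \<otimes> h')"
    using intertwine_int_pow[of h' "a [^] q'" "a [^] p'" q] pq'(3) by simp
  also have "\<dots> = (h \<otimes> (a [^] q) [^] p') \<otimes> h'"
    by (simp add: m_assoc int_pow_pow mult.commute)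
  also have "\<dots> = ((a [^] p) [^] p' \<otimes> h) \<otimes> h'"
    using intertwine_int_pow[of h "a [^] q" "a [^] p" p'] pq(3) by simp
  also have "\<dots> = a [^] (p * p') \<otimes> (h \<otimes> h')"
    by (simp add: m_assoc int_pow_pow)
  finally show ?thesis
    unfolding elementary_closure_def using pq pq'
    by (intro CollectI conjI exI[of _ "p * p'"] exI[of _ "q' * q"]) auto
qed

lemma elementary_closure_pow:
  assumes [simp]: "a \<in> carrier G" and h: "h \<in> elementary_closure a"
  shows "h [^] (n::nat) \<in> elementary_closure a"
proof (induction n)
  case 0
  show ?case
    unfolding elementary_closure_def
    by (intro CollectI conjI exI[of _ "1::int"]) auto
qed (use elementary_closure_mult[OF _ _ h] in simp)

text \<open>
  The element \<open>h\<close> carries the axis of \<open>a\<close> to a line with the same ends at infinity: far out,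
  \<open>h a\<^sup>q\<^sup>m = a\<^sup>p\<^sup>m h\<close> stays at distance \<open>len h\<close> from \<open>a\<^sup>p\<^sup>m\<close>. So \<open>h\<close>, which lies between the far points of its own
  line, also lies between far points of the axis, and the bound \<open>C\<close> does not depend on \<open>h\<close>.
\<close>

lemma elementary_closure_near_axis:
  assumes lox: "loxodromic a"
  shows "\<exists>C. \<forall>h \<in> elementary_closure a. \<exists>i::int. len (inv h \<otimes> a [^] i) \<le> C"
proof -
  have [simp]: "a \<in> carrier G" using lox by simp
  obtain c where "c \<ge> 0" and c: "\<And>i k m::int. (i - k) * (m - k) \<le> 0 \<Longrightarrow> gp (a [^] k) (a [^] i) (a [^] m) \<le> c"
    using loxodromic_between[OF lox] by blast
  define c1 where "c1 = c + 2 * \<delta>"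
  have "c1 \<ge> 0" "c \<le> c1" using \<open>c \<ge> 0\<close> delta_nonneg by (simp_all add: c1_def)
  define C where "C = len a + 4 * c1 + 2 * \<delta>"
  have "\<exists>i::int. len (inv h \<otimes> a [^] i) \<le> C" if h: "h \<in> elementary_closure a" for h
  proof -
    have [simp]: "h \<in> carrier G" using h by (rule elementary_closure_carrier)
    obtain p q :: int where pq: "p \<noteq> 0" "q \<noteq> 0" and rel: "h \<otimes> a [^] q = a [^] p \<otimes> h"
      using h unfolding elementary_closure_def by blast
    obtain n :: nat where n: "\<And>m::int. \<bar>m\<bar> \<ge> int n \<Longrightarrow> len (a [^] m) \<ge> c1 + len h + 1"
      using loxodromic_pow_large[OF lox, of "c1 + len h + 1"] by blast
    have ends: "gp h (h \<otimes> a [^] (q * m)) (a [^] (p * m)) > c1" if "\<bar>m\<bar> = int n" for m :: int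
    proof -
      have "h \<otimes> a [^] (q * m) = a [^] (p * m) \<otimes> h"
        using intertwine_int_pow[of h "a [^] q" "a [^] p" m] rel by (simp add: int_pow_pow)
      then have dist: "d (a [^] (p * m)) (h \<otimes> a [^] (q * m)) = len h" by simp
      have "\<bar>q * m\<bar> \<ge> int n"
        using that mult_right_mono[of 1 "\<bar>q\<bar>" "int n"] pq by (simp add: abs_mult)
      then have "len (a [^] (q * m)) \<ge> c1 + len h + 1" by (rule n)
      moreover have "d h (h \<otimes> a [^] (q * m)) = len (a [^] (q * m))" by simp
      ultimately show ?thesis
        using dist d_sym[of "a [^] (p * m)" "h \<otimes> a [^] (q * m)"] d_sym[of h "h \<otimes> a [^] (q * m)"]
          d_sym[of h "a [^] (p * m)"] d_triangle[of h "a [^] (p * m)" "h \<otimes> a [^] (q * m)"]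
        unfolding gromov_product_def by (simp add: field_simps)
    qed
    \<comment> \<open>\<open>A\<close> and \<open>B\<close> are the far points on the line through \<open>h\<close>; \<open>A'\<close> and \<open>B'\<close> are those on the axis of \<open>a\<close>.\<close>
    define A B A' B' where "A = h \<otimes> a [^] (q * int n)" and "B = h \<otimes> a [^] (q * - int n)"
      and "A' = a [^] (p * int n)" and "B' = a [^] (p * - int n)"
    have [simp]: "A \<in> carrier G" "B \<in> carrier G" "A' \<in> carrier G" "B' \<in> carrier G"
      by (simp_all add: A_def B_def A'_def B'_def)
    have "gp h B A \<le> c"
      using c[of "q * - int n" 0 "q * int n"] gp_translate[of h \<one> "a [^] (q * - int n)" "a [^] (q * int n)"]
      unfolding A_def B_def by (auto simp: mult_le_0_iff zero_le_mult_iff)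
    moreover have "gp h A' A > c + \<delta>"
      using ends[of "int n"] gp_sym[of A A' h] delta_nonneg unfolding A_def A'_def c1_def by simp
    ultimately have "gp h B A' \<le> c + \<delta>" by (intro gp_min_le[of h B A' A]) auto
    then have "gp h A' B \<le> c + \<delta>" using gp_sym[of B A' h] by simp
    moreover have "gp h B' B > c + \<delta> + \<delta>"
      using ends[of "- int n"] gp_sym[of B B' h] unfolding B_def B'_def c1_def by simp
    ultimately have mid: "gp h A' B' \<le> c1"
      using gp_min_le[of h A' B' B "c + \<delta>"] unfolding c1_def by simp
    define k where "k = \<bar>p * int n\<bar>"
    have "k \<ge> 0" by (simp add: k_def)
    define x y where "x = a [^] (- k)" and "y = a [^] k"
    have [simp]: "x \<in> carrier G" "y \<in> carrier G" by (simp_all add: x_def y_def)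
    have hxy: "gp h x y \<le> c1"
    proof (cases "p * int n \<ge> 0")
      case True
      then have "x = B'" "y = A'" by (simp_all add: x_def y_def A'_def B'_def k_def)
      then show ?thesis using mid gp_sym[of A' B' h] by simp
    next
      case False
      then have "x = A'" "y = B'" by (simp_all add: x_def y_def A'_def B'_def k_def)
      then show ?thesis using mid by simp
    qed
    \<comment> \<open>Walk along the axis from one far point to the other until the distance from the start is
      that of \<open>h\<close>; then \<open>close_if_between\<close> applies.\<close>
    define f where "f = (\<lambda>i::nat. d x (a [^] (int i - k)))"
    have "\<exists>i\<le>nat (2 * k). \<bar>f i - d x h\<bar> \<le> len a + 2 * c1"
    proof (rule discrete_intermediate_value)
      show "f 0 \<le> d x h + 2 * c1"
        using \<open>c1 \<ge> 0\<close> d_nonneg[of x h] by (simp add: f_def x_def)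
      have "f (nat (2 * k)) = d x y" using \<open>k \<ge> 0\<close> by (simp add: f_def y_def)
      then show "d x h \<le> f (nat (2 * k)) + 2 * c1"
        using hxy d_nonneg[of y h] unfolding gromov_product_def by simp
      show "\<bar>f (Suc i) - f i\<bar> \<le> len a" for i
      proof -
        have "a [^] (int (Suc i) - k) = a [^] (int i - k) \<otimes> a"
          using int_pow_mult[of a "int i - k" 1] by (simp add: algebra_simps)
        then have "d (a [^] (int i - k)) (a [^] (int (Suc i) - k)) = len a" by simp
        then show ?thesis
          using d_triangle[of x "a [^] (int i - k)" "a [^] (int (Suc i) - k)"]
            d_triangle[of x "a [^] (int (Suc i) - k)" "a [^] (int i - k)"]
            d_sym[of "a [^] (int i - k)" "a [^] (int (Suc i) - k)"]
          by (simp add: f_def abs_le_iff)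
      qed
    qed (use \<open>c1 \<ge> 0\<close> len_nonneg in auto)
    then obtain i where i: "i \<le> nat (2 * k)" "\<bar>f i - d x h\<bar> \<le> len a + 2 * c1" by blast
    define z where "z = a [^] (int i - k)"
    have [simp]: "z \<in> carrier G" by (simp add: z_def)
    have "gp z x y \<le> c"
      unfolding z_def x_def y_def using i(1) \<open>k \<ge> 0\<close>
      by (intro c) (auto simp: mult_le_0_iff zero_le_mult_iff)
    then have "d h z \<le> \<bar>d x h - d x z\<bar> + 2 * c1 + 2 * \<delta>"
      using hxy \<open>c \<le> c1\<close> by (intro close_if_between[of x y]) auto
    then have "d h z \<le> C" using i(2) by (simp add: C_def f_def z_def abs_minus_commute)
    then show ?thesis unfolding d_def z_def by blast
  qed
  then show ?thesis by blast
qed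

text \<open>
  All powers of \<open>z\<close> lie within the same distance of the axis of \<open>a\<close>, so two of them differ by powers
  of \<open>a\<close> only.
\<close>

lemma elementary_closure_root:
  assumes lox: "loxodromic a" and z: "z \<in> elementary_closure a"
  shows "\<exists>(r::nat) (t::int). r > 0 \<and> z [^] r = a [^] t"
proof -
  have [simp]: "a \<in> carrier G" "z \<in> carrier G" using lox z by (simp_all add: elementary_closure_carrier)
  obtain C where C: "\<And>h. h \<in> elementary_closure a \<Longrightarrow> \<exists>i::int. len (inv h \<otimes> a [^] i) \<le> C"
    using elementary_closure_near_axis[OF lox] by blast
  have "\<forall>n::nat. \<exists>i::int. len (inv (z [^] n) \<otimes> a [^] i) \<le> C"
    using C elementary_closure_pow[OF _ z] by simp
  then obtain \<sigma> :: "nat \<Rightarrow> int" where \<sigma>: "\<And>n. len (inv (z [^] n) \<otimes> a [^] (\<sigma> n)) \<le> C"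
    by metis
  define F where "F = (\<lambda>n. inv (z [^] n) \<otimes> a [^] (\<sigma> n))"
  have "range F \<subseteq> {x \<in> carrier G. len x \<le> C}" using \<sigma> by (auto simp: F_def)
  then have "finite (range F)" using finite_ball finite_subset by blast
  then have "\<not> inj F" using finite_imageD infinite_UNIV_nat by blast
  then obtain m n where "m < n" "F m = F n" unfolding inj_def by (metis linorder_neqE_nat)
  have "z [^] (n - m) \<otimes> z [^] m = z [^] n" using \<open>m < n\<close> by (simp add: nat_pow_mult)
  then have "z [^] (n - m) = z [^] n \<otimes> inv (z [^] m)"
    using mult_inv_cancel(3)[of "z [^] m" "z [^] (n - m)"] by simp
  also have "inv (z [^] m) = F m \<otimes> inv (a [^] \<sigma> m)" by (simp add: F_def mult_inv_cancel)
  also have "z [^] n \<otimes> (F m \<otimes> inv (a [^] \<sigma> m)) = a [^] (\<sigma> n - \<sigma> m)"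
    unfolding \<open>F m = F n\<close> by (simp add: F_def int_pow_diff mult_inv_cancel flip: m_assoc)
  finally show ?thesis using \<open>m < n\<close> by (intro exI[of _ "n - m"] exI[of _ "\<sigma> n - \<sigma> m"]) simp
qed

section \<open>Conjugates of a loxodromic element that avoid a finite set\<close>

lemma nat_pow_ne_one:
  assumes "torsion_free G" "z \<in> carrier G" "z \<noteq> \<one>" "(r::nat) > 0"
  shows "z [^] r \<noteq> \<one>"
  using assms unfolding torsion_free_def by blast

text \<open>
  A nontrivial element \<open>z\<close> that has powers in two conjugates of the cyclic group of \<open>a\<close> forces these
  conjugates to have a common nontrivial element, by torsion-freeness, so that \<open>s'\<inverse> s\<close> conjugates
  a power of \<open>a\<close> to a power of \<open>a\<close>.
\<close>

lemma common_root_imp_elementary_closure: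
  fixes r r' :: nat and t t' :: int
  assumes lox: "loxodromic a" and tf: "torsion_free G"
    and [simp]: "s \<in> carrier G" "s' \<in> carrier G" and z: "z \<in> carrier G" "z \<noteq> \<one>"
    and "r > 0" "r' > 0" and zs: "z [^] r = (s \<otimes> a \<otimes> inv s) [^] t" "z [^] r' = (s' \<otimes> a \<otimes> inv s') [^] t'"
  shows "inv s' \<otimes> s \<in> elementary_closure a"
proof -
  have [simp]: "a \<in> carrier G" using lox by simp
  have "t \<noteq> 0" "t' \<noteq> 0"
    using zs nat_pow_ne_one[OF tf z] \<open>r > 0\<close> \<open>r' > 0\<close> by auto
  have pow: "z [^] (int n * int m) = s1 \<otimes> a [^] (u * int m) \<otimes> inv s1"
    if "z [^] n = (s1 \<otimes> a \<otimes> inv s1) [^] u" and [simp]: "s1 \<in> carrier G" for n m :: nat and s1 u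
  proof -
    have "z [^] (int n * int m) = (z [^] n) [^] int m"
      using z(1) by (simp add: int_pow_pow flip: int_pow_int)
    also have "\<dots> = (s1 \<otimes> a \<otimes> inv s1) [^] (u * int m)"
      unfolding that(1) by (simp add: int_pow_pow)
    finally show ?thesis by (simp add: conj_int_pow)
  qed
  have "s \<otimes> a [^] (t * int r') \<otimes> inv s = s' \<otimes> a [^] (t' * int r) \<otimes> inv s'"
    using pow[OF zs(1), of r'] pow[OF zs(2), of r] by (simp add: mult.commute)
  then have "inv s' \<otimes> (s \<otimes> a [^] (t * int r') \<otimes> inv s) \<otimes> s =
      inv s' \<otimes> (s' \<otimes> a [^] (t' * int r) \<otimes> inv s') \<otimes> s" by simp
  then have "(inv s' \<otimes> s) \<otimes> a [^] (t * int r') = a [^] (t' * int r) \<otimes> (inv s' \<otimes> s)"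
    by (simp add: m_assoc mult_inv_cancel)
  then show ?thesis
    unfolding elementary_closure_def using \<open>t \<noteq> 0\<close> \<open>t' \<noteq> 0\<close> \<open>r > 0\<close> \<open>r' > 0\<close>
    by (intro CollectI conjI exI[of _ "t' * int r"] exI[of _ "t * int r'"]) auto
qed

text \<open>
  If every conjugate meets \<open>Z\<close>, choose such an element \<open>\<zeta> s\<close> for every \<open>s\<close>. Those \<open>s\<close> that
  share the same \<open>\<zeta> s\<close> lie in one left coset of the elementary closure of \<open>a\<close>, hence in finitely many
  left cosets of the cyclic group of \<open>a\<close>. Since \<open>Z\<close> is finite, the cyclic group would have finite index.
\<close>

lemma exists_conjugate_avoiding:
  assumes lox: "loxodromic a" and tf: "torsion_free G" and nvc: "\<not> virtually_cyclic G"
    and Z: "finite Z" "Z \<subseteq> carrier G - {\<one>}"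
  shows "\<exists>s \<in> carrier G. Z \<inter> elementary_closure (s \<otimes> a \<otimes> inv s) = {}"
proof (rule ccontr)
  assume "\<not> ?thesis"
  then have "\<forall>s \<in> carrier G. \<exists>z. z \<in> Z \<and> z \<in> elementary_closure (s \<otimes> a \<otimes> inv s)" by blast
  then obtain \<zeta> where \<zeta>: "\<And>s. s \<in> carrier G \<Longrightarrow> \<zeta> s \<in> Z \<and> \<zeta> s \<in> elementary_closure (s \<otimes> a \<otimes> inv s)"
    by metis
  have [simp]: "a \<in> carrier G" using lox by simp
  obtain C where C: "\<And>h. h \<in> elementary_closure a \<Longrightarrow> \<exists>i::int. len (inv h \<otimes> a [^] i) \<le> C"
    using elementary_closure_near_axis[OF lox] by blast
  define B where "B = {x \<in> carrier G. len x \<le> C}"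
  have "finite B" unfolding B_def by (rule finite_ball)
  define \<rho> where "\<rho> z = (SOME s. s \<in> carrier G \<and> \<zeta> s = z)" for z
  let ?A = "generate G {a}"
  have sub: "subgroup ?A G" by (rule generate_is_subgroup) simp
  have "rcosets ?A \<subseteq> (\<lambda>(z, f). ?A #> (inv f \<otimes> inv (\<rho> z))) ` (Z \<times> B)"
  proof
    fix Co assume "Co \<in> rcosets ?A"
    then obtain g where g [simp]: "g \<in> carrier G" and Co: "Co = ?A #> g"
      unfolding RCOSETS_def by blast
    \<comment> \<open>The coset argument concerns left cosets; the inverse turns it into one about right cosets.\<close>
    define s where "s = inv g"
    define z where "z = \<zeta> s"
    define s' where "s' = \<rho> z"
    have [simp]: "s \<in> carrier G" by (simp add: s_def)
    have "s' \<in> carrier G \<and> \<zeta> s' = z"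
      unfolding s'_def \<rho>_def by (rule someI[of _ s]) (simp add: z_def)
    then have [simp]: "s' \<in> carrier G" and "\<zeta> s' = z" by auto
    have z: "z \<in> Z" "z \<in> elementary_closure (s \<otimes> a \<otimes> inv s)" "z \<in> elementary_closure (s' \<otimes> a \<otimes> inv s')"
      using \<zeta>[of s] \<zeta>[of s'] \<open>\<zeta> s' = z\<close> by (auto simp: z_def)
    then have "z \<in> carrier G" "z \<noteq> \<one>" using Z by auto
    obtain r :: nat and t :: int where rt: "r > 0" "z [^] r = (s \<otimes> a \<otimes> inv s) [^] t"
      using elementary_closure_root[OF loxodromic_conj[OF lox] z(2)] by auto
    obtain r' :: nat and t' :: int where rt': "r' > 0" "z [^] r' = (s' \<otimes> a \<otimes> inv s') [^] t'"
      using elementary_closure_root[OF loxodromic_conj[OF lox] z(3)] by auto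
    have "inv s \<otimes> s' \<in> elementary_closure a"
      by (rule common_root_imp_elementary_closure[OF lox tf _ _ \<open>z \<in> carrier G\<close> \<open>z \<noteq> \<one>\<close> rt'(1) rt(1) rt'(2) rt(2)]) auto
    from C[OF this] obtain i :: int where i: "len (inv (inv s \<otimes> s') \<otimes> a [^] i) \<le> C" by blast
    define f where "f = inv s' \<otimes> s \<otimes> a [^] i"
    have f: "f \<in> B" using i by (simp add: B_def f_def inv_mult_group)
    then have [simp]: "f \<in> carrier G" by (simp add: B_def)
    have "inv f \<otimes> inv s' = a [^] (- i) \<otimes> g"
      by (simp add: f_def s_def inv_mult_group int_pow_neg m_assoc)
    then have "?A #> (inv f \<otimes> inv s') = (?A #> a [^] (- i)) #> g"
      using subgroup.subset[OF sub] by (simp add: coset_mult_assoc)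
    also have "?A #> a [^] (- i) = ?A"
    proof (rule coset_join2[OF _ sub])
      show "a [^] (- i) \<in> ?A" by (subst generate_pow) auto
    qed simp
    finally have "Co = ?A #> (inv f \<otimes> inv (\<rho> z))" by (simp add: Co s'_def)
    with z(1) f show "Co \<in> (\<lambda>(z, f). ?A #> (inv f \<otimes> inv (\<rho> z))) ` (Z \<times> B)" by force
  qed
  then have "finite (rcosets ?A)"
    using \<open>finite B\<close> Z(1) by (meson finite_SigmaI finite_imageI finite_subset)
  with nvc show False unfolding virtually_cyclic_def by simp
qed

end

section \<open>Words in one variable with constants\<close>

context group
begin

text \<open>
  The word \<open>g\<^sub>0 x\<^sup>\<plusminus>\<^sup>1 g\<^sub>1 x\<^sup>\<plusminus>\<^sup>1 \<dots> g\<^sub>n\<close>, where a letter consists of the sign (\<open>True\<close> for \<open>+1\<close>) and the constant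
  that follows it. The leading constant is a separate argument, which makes cancellation of two
  letters a matter of multiplying constants.
\<close>

fun mixed_word :: "'a \<Rightarrow> (bool \<times> 'a) list \<Rightarrow> 'a \<Rightarrow> 'a" where
  "mixed_word g [] x = g"
| "mixed_word g ((e, g') # ws) x = g \<otimes> ((if e then x else inv x) \<otimes> mixed_word g' ws x)"

fun reduced :: "(bool \<times> 'a) list \<Rightarrow> bool" where
  "reduced ((e, g) # (e', g') # ws) \<longleftrightarrow> (e = e' \<or> g \<noteq> \<one>) \<and> reduced ((e', g') # ws)"
| "reduced ws \<longleftrightarrow> True"

lemma mixed_word_closed [simp]:
  "g \<in> carrier G \<Longrightarrow> snd ` set ws \<subseteq> carrier G \<Longrightarrow> x \<in> carrier G \<Longrightarrow> mixed_word g ws x \<in> carrier G"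
  by (induction g ws x rule: mixed_word.induct) auto

lemma mixed_word_mult_const:
  "h \<in> carrier G \<Longrightarrow> g \<in> carrier G \<Longrightarrow> snd ` set ws \<subseteq> carrier G \<Longrightarrow> x \<in> carrier G \<Longrightarrow>
    mixed_word (h \<otimes> g) ws x = h \<otimes> mixed_word g ws x"
  by (cases ws) (auto simp: m_assoc)

lemma mixed_word_shorten:
  assumes "\<not> reduced ws" "g \<in> carrier G" "snd ` set ws \<subseteq> carrier G"
  shows "\<exists>g' ws'. g' \<in> carrier G \<and> snd ` set ws' \<subseteq> carrier G \<and> length ws' < length ws \<and>
    (\<forall>x \<in> carrier G. mixed_word g ws x = mixed_word g' ws' x)"
  using assms
proof (induction ws arbitrary: g rule: reduced.induct)
  case (1 e h e' h' ws)
  show ?case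
  proof (cases "e \<noteq> e' \<and> h = \<one>")
    case True
    have "mixed_word g ((e, h) # (e', h') # ws) x = mixed_word (g \<otimes> h') ws x" if "x \<in> carrier G" for x
    proof -
      have "mixed_word h' ws x \<in> carrier G" using 1 that by simp
      then show ?thesis
        using True 1 that by (cases e) (auto simp: mixed_word_mult_const simp flip: m_assoc)
    qed
    then show ?thesis using 1 by (intro exI[of _ "g \<otimes> h'"] exI[of _ ws]) auto
  next
    case False
    then have "\<not> reduced ((e', h') # ws)" using 1 by auto
    then obtain g' ws' where "g' \<in> carrier G" "snd ` set ws' \<subseteq> carrier G"
      "length ws' < length ((e', h') # ws)"
      "\<forall>x \<in> carrier G. mixed_word h ((e', h') # ws) x = mixed_word g' ws' x"
      using 1 by (metis (no_types, lifting) image_insert insert_subset list.simps(15) snd_conv)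
    then show ?thesis
      using 1 by (intro exI[of _ g] exI[of _ "(e, g') # ws'"]) auto
  qed
qed auto

text \<open>
  Each cancellation \<open>x 1 x\<inverse>\<close> shortens the word and keeps its values.
\<close>

lemma mixed_word_reduce:
  assumes "g \<in> carrier G" "snd ` set ws \<subseteq> carrier G"
  shows "\<exists>g' ws'. g' \<in> carrier G \<and> snd ` set ws' \<subseteq> carrier G \<and> reduced ws' \<and>
    (\<forall>x \<in> carrier G. mixed_word g ws x = mixed_word g' ws' x)"
  using assms
proof (induction "length ws" arbitrary: g ws rule: less_induct)
  case less
  show ?case
  proof (cases "reduced ws")
    case True
    then show ?thesis using less.prems by blast
  next
    case False
    then obtain g' ws' where "g' \<in> carrier G" "snd ` set ws' \<subseteq> carrier G" "length ws' < length ws"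
      and eq: "\<forall>x \<in> carrier G. mixed_word g ws x = mixed_word g' ws' x"
      using mixed_word_shorten[OF _ less.prems] by blast
    then show ?thesis using less.hyps[of ws' g'] by (metis (no_types, lifting))
  qed
qed

end

section \<open>Words that are trivial on a coset of a normal subgroup\<close>

context hyperbolic_length
begin

text \<open>
  The value at \<open>x = b\<^sup>m v\<close> is a product of powers \<open>b\<^sup>\<plusminus>\<^sup>m\<close> and of connecting elements from the set \<open>Z\<close>.
  For reduced words and suitable \<open>v\<close> these are nontrivial, and a suitable conjugate \<open>b\<close> of a loxodromic
  element of \<open>N\<close> has none of them in its elementary closure. The induction \<open>follows\<close> runs from the
  last letter to the first: each tail of the product starts along its first power of \<open>b\<close>
  for at least the length \<open>T\<close>, because the connecting element prevents the rest from backtracking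
  along that power by more than a bounded amount.
\<close>

lemma reduced_word_nontrivial_on_coset:
  assumes tf: "torsion_free G" and nvc: "\<not> virtually_cyclic G"
    and N: "N \<lhd> G" "N \<noteq> {\<one>}" and u [simp]: "u \<in> carrier G"
    and red: "reduced ws" "ws \<noteq> []" and g [simp]: "g \<in> carrier G" and ws: "snd ` set ws \<subseteq> carrier G"
  shows "\<exists>n \<in> N. u \<otimes> n \<noteq> \<one> \<and> mixed_word g ws (u \<otimes> n) \<noteq> \<one>"
proof -
  interpret N: normal N G by (rule N(1))
  obtain a where a: "a \<in> N" "a \<noteq> \<one>" using N(2) N.one_closed by blast
  then have [simp]: "a \<in> carrier G" using N.subset by blast
  obtain j :: nat and p where p: "p \<in> carrier G" "loxodromic (inv p \<otimes> a [^] j \<otimes> p)"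
    using exists_loxodromic_power[of a] nat_pow_ne_one[OF tf _ a(2)] by auto
  define a0 where "a0 = inv p \<otimes> a [^] j \<otimes> p"
  have lox0: "loxodromic a0" using p by (simp add: a0_def)
  have N_pow: "x [^] i \<in> N" if "x \<in> N" for x and i :: int
    using subgroup_int_pow_closed[OF N.is_subgroup that] .
  have a0: "a0 \<in> N"
    unfolding a0_def using N_pow[OF a(1), of "int j"] p(1) by (simp add: int_pow_int N.inv_op_closed1)
  have [simp]: "a0 \<in> carrier G" using lox0 by simp
  have inj0: "inj (\<lambda>i::int. u \<otimes> a0 [^] i)"
  proof (rule injI)
    fix i i' :: int assume "u \<otimes> a0 [^] i = u \<otimes> a0 [^] i'"
    then have "a0 [^] i = a0 [^] i'" by simp
    then have "a0 [^] (i - i') = \<one>" by (simp add: int_pow_diff)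
    then show "i = i'" using loxodromic_pow_eq_one[OF lox0] by fastforce
  qed
  define S where "S = snd ` set ws"
  have S: "finite S" "S \<subseteq> carrier G" using ws by (simp_all add: S_def)
  have "infinite (range (\<lambda>i::int. u \<otimes> a0 [^] i))"
    using inj0 finite_imageD infinite_UNIV_int by blast
  moreover have "finite (S \<union> m_inv G ` S)" using S by simp
  \<comment> \<open>Avoiding the constants of the word and their inverses makes \<open>v h\<close> and \<open>h v\<inverse>\<close> nontrivial, as
    required for connecting elements between letters of equal sign.\<close>
  ultimately obtain k :: int where k: "u \<otimes> a0 [^] k \<notin> S \<union> m_inv G ` S"
    by (meson finite_subset image_subset_iff)
  define v where "v = u \<otimes> a0 [^] k"
  have [simp]: "v \<in> carrier G" by (simp add: v_def)
  have v: "v \<otimes> h \<noteq> \<one>" "h \<otimes> inv v \<noteq> \<one>" if "h \<in> S" for h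
  proof -
    have [simp]: "h \<in> carrier G" using that S by blast
    show "v \<otimes> h \<noteq> \<one>"
    proof
      assume "v \<otimes> h = \<one>"
      then have "v = inv h" using inv_equality[of v h] by simp
      then show False using k that unfolding v_def[symmetric] by blast
    qed
    show "h \<otimes> inv v \<noteq> \<one>"
    proof
      assume "h \<otimes> inv v = \<one>"
      then have "h = v" using inv_equality[of h "inv v"] by simp
      then show False using k that unfolding v_def[symmetric] by blast
    qed
  qed
  \<comment> \<open>The letter \<open>x\<close> is \<open>b\<^sup>m v\<close> and \<open>x\<inverse>\<close> is \<open>v\<inverse> b\<^sup>-\<^sup>m\<close>: in terms of \<open>b\<^sup>\<plusminus>\<^sup>m\<close>, the factor \<open>v\<close> comes after, \<open>v\<inverse>\<close> before.\<close>
  define post where "post e = (if e then v else \<one>)" for e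
  define pre where "pre e = (if e then \<one> else inv v)" for e
  have [simp]: "post e \<in> carrier G" "pre e \<in> carrier G" for e by (simp_all add: post_def pre_def)
  define Z where "Z = (\<lambda>(e, h, e'). post e \<otimes> h \<otimes> pre e') ` {(e, h, e'). h \<in> S \<and> (e = e' \<or> h \<noteq> \<one>)}"
  have "finite {(e::bool, h, e'::bool). h \<in> S \<and> (e = e' \<or> h \<noteq> \<one>)}"
    by (rule finite_subset[of _ "UNIV \<times> S \<times> UNIV"]) (use S in auto)
  then have "finite Z" unfolding Z_def by simp
  have Z: "Z \<subseteq> carrier G - {\<one>}"
  proof -
    have "post e \<otimes> h \<otimes> pre e' \<noteq> \<one>" if h: "h \<in> S" "e = e' \<or> h \<noteq> \<one>" for e h e'
    proof -
      have [simp]: "h \<in> carrier G" using that S by blast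
      have "h = \<one>" if "v \<otimes> h \<otimes> inv v = \<one>"
      proof -
        have "h = inv v \<otimes> (v \<otimes> h \<otimes> inv v) \<otimes> v" by (simp add: m_assoc mult_inv_cancel)
        then show ?thesis unfolding that by simp
      qed
      then show ?thesis using v[OF h(1)] h(2) by (auto simp: post_def pre_def)
    qed
    then show ?thesis using S by (auto simp: Z_def)
  qed
  obtain s where [simp]: "s \<in> carrier G" and s: "Z \<inter> elementary_closure (s \<otimes> a0 \<otimes> inv s) = {}"
    using exists_conjugate_avoiding[OF lox0 tf nvc \<open>finite Z\<close> Z] by blast
  define b where "b = s \<otimes> a0 \<otimes> inv s"
  have lox: "loxodromic b" unfolding b_def using lox0 by (rule loxodromic_conj) simp
  then have [simp]: "b \<in> carrier G" by simp
  have "b \<in> N" unfolding b_def using a0 by (simp add: N.inv_op_closed2)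
  define sgn where "sgn e = (if e then 1 else - 1 :: int)" for e
  have "\<exists>D\<ge>0. \<forall>z\<in>Z. \<forall>e e'. \<forall>m::nat.
    gp \<one> (b [^] (sgn e * int m)) (z \<otimes> b [^] (sgn e' * int m)) \<le> D"
  proof -
    have "\<forall>i \<in> Z \<times> UNIV \<times> UNIV. \<exists>D. \<forall>m::nat.
      gp \<one> (b [^] (sgn (fst (snd i)) * int m)) (fst i \<otimes> b [^] (sgn (snd (snd i)) * int m)) \<le> D"
    proof
      fix i :: "'a \<times> bool \<times> bool" assume "i \<in> Z \<times> UNIV \<times> UNIV"
      then have "fst i \<in> Z" by auto
      then have "fst i \<in> carrier G" "fst i \<notin> elementary_closure b"
        using s Z by (auto simp: b_def)
      then show "\<exists>D. \<forall>m::nat.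
          gp \<one> (b [^] (sgn (fst (snd i)) * int m)) (fst i \<otimes> b [^] (sgn (snd (snd i)) * int m)) \<le> D"
        by (rule bounded_divergence[OF lox]) (simp_all add: sgn_def)
    qed
    then obtain D where D: "\<And>i m. i \<in> Z \<times> UNIV \<times> UNIV \<Longrightarrow>
      gp \<one> (b [^] (sgn (fst (snd i)) * int m)) (fst i \<otimes> b [^] (sgn (snd (snd i)) * int m)) \<le> D i"
      by metis
    define D0 where "D0 = Max (insert 0 (D ` (Z \<times> UNIV \<times> UNIV)))"
    have fin: "finite (insert 0 (D ` (Z \<times> UNIV \<times> UNIV)))" using \<open>finite Z\<close> by simp
    have "gp \<one> (b [^] (sgn e * int m)) (z \<otimes> b [^] (sgn e' * int m)) \<le> D0" if "z \<in> Z" for z e e' m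
    proof -
      have "D (z, e, e') \<le> D0" unfolding D0_def using that by (intro Max_ge[OF fin]) auto
      then show ?thesis using D[of "(z, e, e')" m] that by simp
    qed
    moreover have "D0 \<ge> 0" unfolding D0_def by (intro Max_ge[OF fin]) simp
    ultimately show ?thesis by blast
  qed
  then obtain D where "D \<ge> 0" and D: "\<And>z e e' m. z \<in> Z \<Longrightarrow>
    gp \<one> (b [^] (sgn e * int m)) (z \<otimes> b [^] (sgn e' * int m)) \<le> D"
    by blast
  define Y where "Y = Z \<union> (\<lambda>(e, h). post e \<otimes> h) ` (UNIV \<times> S) \<union> (\<lambda>e. g \<otimes> pre e) ` UNIV \<union> {v}"
  have "finite Y" using \<open>finite Z\<close> S by (simp add: Y_def)
  define H where "H = Max (len ` Y)"
  have H: "len y \<le> H" if "y \<in> Y" for y unfolding H_def using \<open>finite Y\<close> that by simp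
  have "H \<ge> 0" using H[of v] len_nonneg[of v] by (simp add: Y_def)
  \<comment> \<open>\<open>T\<close> is just large enough for the next connecting element: it has length at most \<open>H\<close>, and a
    common segment longer than \<open>D + \<delta>\<close> must remain. The powers of \<open>b\<close> have length at least \<open>T\<close> plus
    the loss of at most \<open>D + \<delta> + H\<close> in each step.\<close>
  define T where "T = D + \<delta> + H + 1"
  obtain m :: nat where m: "\<And>i::int. \<bar>i\<bar> \<ge> int m \<Longrightarrow> len (b [^] i) \<ge> D + \<delta> + H + T"
    using loxodromic_pow_large[OF lox, of "D + \<delta> + H + T"] by blast
  define pw where "pw e = b [^] (sgn e * int m)" for e
  have [simp]: "pw e \<in> carrier G" for e by (simp add: pw_def)
  have len_pw: "len (pw e) \<ge> D + \<delta> + H + T" for e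
    unfolding pw_def by (rule m) (simp add: sgn_def)
  have inv_pw: "inv (pw e) = pw (\<not> e)" for e
    by (simp add: pw_def sgn_def int_pow_neg)
  define x where "x = b [^] int m \<otimes> v"
  have [simp]: "x \<in> carrier G" by (simp add: x_def)
  have x_pow: "(if e then x else inv x) = pre e \<otimes> (pw e \<otimes> post e)" for e
    by (simp add: x_def pre_def post_def pw_def sgn_def inv_mult_group int_pow_neg)
  define tail where "tail e h ws' = pw e \<otimes> (post e \<otimes> mixed_word h ws' x)" for e h ws'
  have unfold_tail: "mixed_word g' ((e, h) # ws') x = g' \<otimes> pre e \<otimes> tail e h ws'"
    if "g' \<in> carrier G" "h \<in> carrier G" "snd ` set ws' \<subseteq> carrier G" for g' e h ws'
    using that by (simp only: mixed_word.simps x_pow tail_def) (simp add: m_assoc)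
  have follows: "gp \<one> (pw e) (tail e h ws') \<ge> T"
    if "reduced ((e, h) # ws')" "set ((e, h) # ws') \<subseteq> set ws" for e h ws'
    using that
  proof (induction ws' arbitrary: e h)
    case Nil
    then have "h \<in> S" by (auto simp: S_def intro: rev_image_eqI)
    then have [simp]: "h \<in> carrier G" using S by blast
    have "gp (pw e) \<one> (tail e h []) \<le> d (pw e) (tail e h [])"
      using gp_le[of "pw e" "tail e h []" \<one>] gp_sym[of "tail e h []" \<one> "pw e"] by (simp add: tail_def)
    also have "\<dots> = len (post e \<otimes> h)" by (simp add: tail_def)
    also have "\<dots> \<le> H" using \<open>h \<in> S\<close> by (intro H) (auto simp: Y_def)
    finally show ?case
      using gp_swap[of "pw e" \<one> "tail e h []"] len_pw[of e] \<open>D \<ge> 0\<close> delta_nonneg by (simp add: tail_def)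
  next
    case (Cons w ws')
    obtain e' h' where w: "w = (e', h')" by force
    have "h \<in> S" "h' \<in> S" using Cons.prems(2) by (auto simp: S_def w intro: rev_image_eqI)
    then have [simp]: "h \<in> carrier G" "h' \<in> carrier G" using S by blast+
    have ws': "snd ` set ws' \<subseteq> carrier G" using Cons.prems(2) ws by auto
    define z t where "z = post e \<otimes> h \<otimes> pre e'" and "t = tail e' h' ws'"
    have [simp]: "z \<in> carrier G" "t \<in> carrier G" using ws' by (simp_all add: z_def t_def tail_def)
    have "z \<in> Z"
      using \<open>h \<in> S\<close> Cons.prems(1) unfolding z_def Z_def w by (intro rev_image_eqI[of "(e, h, e')"]) auto
    then have "len z \<le> H" by (intro H) (simp add: Y_def)
    have tail_eq: "tail e h (w # ws') = pw e \<otimes> (z \<otimes> t)"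
      using ws' unfolding w tail_def[of e] by (subst unfold_tail) (simp_all add: z_def t_def m_assoc tail_def)
    have "gp \<one> (pw e') t \<ge> T"
      unfolding t_def using Cons.prems by (intro Cons.IH) (auto simp: w)
    then have "gp z (z \<otimes> t) (z \<otimes> pw e') \<ge> T"
      using gp_translate[of z \<one> t "pw e'"] gp_sym[of "pw e'" t \<one>] by simp
    then have "gp \<one> (z \<otimes> t) (z \<otimes> pw e') > D + \<delta>"
      using gp_move_base[of z \<one> "z \<otimes> t" "z \<otimes> pw e'"] \<open>len z \<le> H\<close> by (simp add: T_def)
    moreover have "gp \<one> (inv (pw e)) (z \<otimes> pw e') \<le> D"
      unfolding inv_pw unfolding pw_def by (rule D[OF \<open>z \<in> Z\<close>])
    ultimately have "gp \<one> (inv (pw e)) (z \<otimes> t) \<le> D + \<delta>"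
      by (intro gp_min_le[of \<one> "inv (pw e)" "z \<otimes> t" "z \<otimes> pw e'"]) auto
    then have "gp (pw e) \<one> (pw e \<otimes> (z \<otimes> t)) \<le> D + \<delta>"
      using gp_translate[of "pw e" \<one> "inv (pw e)" "z \<otimes> t"] by simp
    then show ?case
      unfolding tail_eq using gp_swap[of "pw e" \<one> "pw e \<otimes> (z \<otimes> t)"] len_pw[of e] \<open>H \<ge> 0\<close> by simp
  qed
  obtain e h ws' where ws_eq: "ws = (e, h) # ws'" using red(2) by (metis neq_Nil_conv surj_pair)
  have [simp]: "h \<in> carrier G" and ws': "snd ` set ws' \<subseteq> carrier G" using ws by (auto simp: ws_eq)
  have [simp]: "tail e h ws' \<in> carrier G" using ws' by (simp add: tail_def)
  have "len (tail e h ws') \<ge> T"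
    using follows[of e h ws'] red(1) ws_eq gp_le[of \<one> "tail e h ws'" "pw e"]
      gp_sym[of "tail e h ws'" "pw e" \<one>] by simp
  moreover have "len (g \<otimes> pre e) \<le> H" by (rule H) (auto simp: Y_def)
  ultimately have longer: "len (tail e h ws') > len (g \<otimes> pre e)"
    using \<open>D \<ge> 0\<close> delta_nonneg by (simp add: T_def)
  have "mixed_word g ws x \<noteq> \<one>"
  proof
    assume "mixed_word g ws x = \<one>"
    then have "(g \<otimes> pre e) \<otimes> tail e h ws' = \<one>"
      unfolding ws_eq using ws' by (subst (asm) unfold_tail) auto
    then have "inv (tail e h ws') = g \<otimes> pre e" by (intro inv_equality) auto
    then show False using longer len_inv[of "tail e h ws'"] by simp
  qed
  moreover have "x \<noteq> \<one>"
  proof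
    assume "x = \<one>"
    then have "inv v = b [^] int m" unfolding x_def by (intro inv_equality) auto
    then have "len (b [^] int m) \<le> H" using len_inv[of v] H[of v] by (simp add: Y_def)
    then show False using m[of "int m"] \<open>D \<ge> 0\<close> \<open>H \<ge> 0\<close> delta_nonneg by (simp add: T_def)
  qed
  moreover have "inv u \<otimes> x \<in> N"
  proof -
    have "inv u \<otimes> x = (inv u \<otimes> b [^] int m \<otimes> u) \<otimes> a0 [^] k"
      by (simp add: x_def v_def m_assoc)
    moreover have "inv u \<otimes> b [^] int m \<otimes> u \<in> N"
      by (rule N.inv_op_closed1[OF u N_pow[OF \<open>b \<in> N\<close>]])
    ultimately show ?thesis using N_pow[OF a0] by simp
  qed
  moreover have "u \<otimes> (inv u \<otimes> x) = x" by (simp add: mult_inv_cancel)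
  ultimately show ?thesis by metis
qed

text \<open>
  A word and its reduced form have the same values. The reduced form cannot contain a letter, so
  it is a constant, and the coset has an element other than \<open>1\<close> at which this constant is trivial.
\<close>

lemma word_vanishing_on_coset:
  assumes tf: "torsion_free G" and nvc: "\<not> virtually_cyclic G"
    and N: "N \<lhd> G" "N \<noteq> {\<one>}" and u [simp]: "u \<in> carrier G"
    and w: "g \<in> carrier G" "snd ` set ws \<subseteq> carrier G"
    and zero: "\<And>n. n \<in> N \<Longrightarrow> u \<otimes> n \<noteq> \<one> \<Longrightarrow> mixed_word g ws (u \<otimes> n) = \<one>"
    and x: "x \<in> carrier G"
  shows "mixed_word g ws x = \<one>"
proof -
  interpret N: normal N G by (rule N(1))
  obtain g' ws' where g': "g' \<in> carrier G" "snd ` set ws' \<subseteq> carrier G" "reduced ws'"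
    and eq: "\<And>x. x \<in> carrier G \<Longrightarrow> mixed_word g ws x = mixed_word g' ws' x"
    using mixed_word_reduce[OF w] by blast
  have zero': "mixed_word g' ws' (u \<otimes> n) = \<one>" if "n \<in> N" "u \<otimes> n \<noteq> \<one>" for n
    using zero[OF that] eq[of "u \<otimes> n"] that(1) N.subset by (metis N.mem_carrier m_closed u)
  have "ws' = []"
    using reduced_word_nontrivial_on_coset[OF tf nvc N u g'(3) _ g'(1,2)] zero' by blast
  obtain a where a: "a \<in> N" "a \<noteq> \<one>" using N(2) N.one_closed by blast
  have "u \<otimes> a \<noteq> \<one> \<or> u \<otimes> \<one> \<noteq> \<one>"
    using a N.mem_carrier[OF a(1)] by auto
  then have "g' = \<one>"
    using zero'[of a] zero'[of \<one>] a(1) N.one_closed \<open>ws' = []\<close> by auto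
  then show ?thesis using eq[OF x] \<open>ws' = []\<close> by simp
qed

end

section \<open>Word maps in several variables\<close>

context group
begin

definition mixed_word_map :: "('a \<Rightarrow> 'a) \<Rightarrow> bool" where
  "mixed_word_map F \<longleftrightarrow> (\<exists>g ws. g \<in> carrier G \<and> snd ` set ws \<subseteq> carrier G \<and>
     (\<forall>x \<in> carrier G. F x = mixed_word g ws x))"

lemma mixed_word_mapI:
  "g \<in> carrier G \<Longrightarrow> snd ` set ws \<subseteq> carrier G \<Longrightarrow>
    (\<And>x. x \<in> carrier G \<Longrightarrow> F x = mixed_word g ws x) \<Longrightarrow> mixed_word_map F"
  unfolding mixed_word_map_def by blast

lemma mixed_word_mapE:
  assumes "mixed_word_map F"
  obtains g ws where "g \<in> carrier G" "snd ` set ws \<subseteq> carrier G"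
    "\<And>x. x \<in> carrier G \<Longrightarrow> F x = mixed_word g ws x"
  using assms unfolding mixed_word_map_def by blast

lemma mixed_word_map_cong:
  "mixed_word_map F \<Longrightarrow> (\<And>x. x \<in> carrier G \<Longrightarrow> F' x = F x) \<Longrightarrow> mixed_word_map F'"
  unfolding mixed_word_map_def by auto

lemma mixed_word_map_mult:
  assumes "mixed_word_map F" "mixed_word_map F'"
  shows "mixed_word_map (\<lambda>x. F x \<otimes> F' x)"
proof -
  obtain g ws where w: "g \<in> carrier G" "snd ` set ws \<subseteq> carrier G"
    and F: "\<And>x. x \<in> carrier G \<Longrightarrow> F x = mixed_word g ws x"
    using assms(1) by (rule mixed_word_mapE) blast
  obtain g' ws' where w': "g' \<in> carrier G" "snd ` set ws' \<subseteq> carrier G"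
    and F': "\<And>x. x \<in> carrier G \<Longrightarrow> F' x = mixed_word g' ws' x"
    using assms(2) by (rule mixed_word_mapE) blast
  have "mixed_word_map (\<lambda>x. mixed_word g ws x \<otimes> F' x)"
    using w
  proof (induction ws arbitrary: g)
    case Nil
    then show ?case
      using w' F' by (intro mixed_word_mapI[of "g \<otimes> g'" ws']) (auto simp: mixed_word_mult_const)
  next
    case (Cons v ws)
    obtain e h where v: "v = (e, h)" by force
    have h: "h \<in> carrier G" "snd ` set ws \<subseteq> carrier G" using Cons.prems v by auto
    then have "mixed_word_map (\<lambda>x. mixed_word h ws x \<otimes> F' x)" by (rule Cons.IH)
    then obtain h'' ws'' where w'': "h'' \<in> carrier G" "snd ` set ws'' \<subseteq> carrier G"
      and eq: "\<And>x. x \<in> carrier G \<Longrightarrow> mixed_word h ws x \<otimes> F' x = mixed_word h'' ws'' x"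
      by (rule mixed_word_mapE) blast
    have step: "mixed_word g (v # ws) x \<otimes> F' x = mixed_word g ((e, h'') # ws'') x"
      if x: "x \<in> carrier G" for x
    proof -
      have "F' x \<in> carrier G" using F'[OF x] w' x by simp
      then have "mixed_word g (v # ws) x \<otimes> F' x =
          g \<otimes> ((if e then x else inv x) \<otimes> (mixed_word h ws x \<otimes> F' x))"
        using h x Cons.prems(1) by (simp add: v m_assoc)
      then show ?thesis by (simp add: eq[OF x])
    qed
    show ?case
    proof (rule mixed_word_mapI)
      show "g \<in> carrier G" by (rule Cons.prems)
      show "snd ` set ((e, h'') # ws'') \<subseteq> carrier G" using w'' by simp
    qed (rule step)
  qed
  then show ?thesis by (rule mixed_word_map_cong) (simp add: F)
qed

lemma mixed_word_map_const: "g \<in> carrier G \<Longrightarrow> mixed_word_map (\<lambda>_. g)"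
  by (rule mixed_word_mapI[of g "[]"]) auto

lemma mixed_word_map_ident: "mixed_word_map (\<lambda>x. x)"
  by (rule mixed_word_mapI[of \<one> "[(True, \<one>)]"]) auto

lemma mixed_word_map_ident_inv: "mixed_word_map (\<lambda>x. inv x)"
  by (rule mixed_word_mapI[of \<one> "[(False, \<one>)]"]) auto

lemma mixed_word_map_inv:
  assumes "mixed_word_map F"
  shows "mixed_word_map (\<lambda>x. inv (F x))"
proof -
  obtain g ws where w: "g \<in> carrier G" "snd ` set ws \<subseteq> carrier G"
    and F: "\<And>x. x \<in> carrier G \<Longrightarrow> F x = mixed_word g ws x"
    using assms by (rule mixed_word_mapE) blast
  have "mixed_word_map (\<lambda>x. inv (mixed_word g ws x))"
    using w
  proof (induction ws arbitrary: g)
    case Nil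
    then show ?case by (simp add: mixed_word_map_const)
  next
    case (Cons v ws)
    obtain e h where v: "v = (e, h)" by force
    have h: "h \<in> carrier G" "snd ` set ws \<subseteq> carrier G" "g \<in> carrier G" using Cons.prems v by auto
    have "mixed_word_map (\<lambda>x. if e then inv x else x)"
      by (cases e) (simp_all add: mixed_word_map_ident mixed_word_map_ident_inv)
    then have "mixed_word_map (\<lambda>x. inv (mixed_word h ws x) \<otimes> (if e then inv x else x) \<otimes> inv g)"
      by (intro mixed_word_map_mult mixed_word_map_const Cons.IH h inv_closed)
    then show ?case
    proof (rule mixed_word_map_cong)
      fix x assume x: "x \<in> carrier G"
      then have "mixed_word h ws x \<in> carrier G" using h by simp
      then show "inv (mixed_word g (v # ws) x) =
          inv (mixed_word h ws x) \<otimes> (if e then inv x else x) \<otimes> inv g"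
        using x h(3) by (simp add: v inv_mult_group m_assoc)
    qed
  qed
  then show ?thesis by (rule mixed_word_map_cong) (simp add: F)
qed

inductive_set word_maps :: "nat set \<Rightarrow> ((nat \<Rightarrow> 'a) \<Rightarrow> 'a) set" for I where
  const: "g \<in> carrier G \<Longrightarrow> (\<lambda>_. g) \<in> word_maps I"
| proj: "i \<in> I \<Longrightarrow> (\<lambda>u. u i) \<in> word_maps I"
| mult: "\<phi> \<in> word_maps I \<Longrightarrow> \<psi> \<in> word_maps I \<Longrightarrow> (\<lambda>u. \<phi> u \<otimes> \<psi> u) \<in> word_maps I"
| inverse: "\<phi> \<in> word_maps I \<Longrightarrow> (\<lambda>u. inv (\<phi> u)) \<in> word_maps I"

lemma word_map_one_variable:
  assumes "\<phi> \<in> word_maps I" and y: "y \<in> I \<rightarrow> carrier G"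
  shows "mixed_word_map (\<lambda>x. \<phi> (y(j := x)))"
  using assms(1)
proof induction
  case (const g)
  then show ?case by (rule mixed_word_map_const)
next
  case (proj i)
  then have "y i \<in> carrier G" using y by blast
  then show ?case
    using mixed_word_map_const[of "y i"] mixed_word_map_ident by (cases "i = j") simp_all
next
  case (mult \<phi> \<psi>)
  then show ?case by (intro mixed_word_map_mult)
next
  case (inverse \<phi>)
  then show ?case by (intro mixed_word_map_inv)
qed

definition normal_closure :: "'a \<Rightarrow> 'a set" where
  "normal_closure v = generate G ((\<lambda>g. g \<otimes> v \<otimes> inv g) ` carrier G)"

lemma normal_closure_normal:
  assumes [simp]: "v \<in> carrier G"
  shows "normal_closure v \<lhd> G"
  unfolding normal_closure_def
proof (rule normal_generateI)
  fix h g assume "h \<in> (\<lambda>g. g \<otimes> v \<otimes> inv g) ` carrier G" and [simp]: "g \<in> carrier G"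
  then obtain g' where [simp]: "g' \<in> carrier G" and h: "h = g' \<otimes> v \<otimes> inv g'" by blast
  have "g \<otimes> h \<otimes> inv g = (g \<otimes> g') \<otimes> v \<otimes> inv (g \<otimes> g')"
    by (simp add: h inv_mult_group m_assoc)
  then show "g \<otimes> h \<otimes> inv g \<in> (\<lambda>g. g \<otimes> v \<otimes> inv g) ` carrier G"
    by (rule image_eqI) simp
qed auto

lemma in_normal_closure:
  assumes "v \<in> carrier G"
  shows "v \<in> normal_closure v"
proof -
  have "v = \<one> \<otimes> v \<otimes> inv \<one>" using assms by simp
  then show ?thesis unfolding normal_closure_def by (intro generate.incl image_eqI[of _ _ \<one>]) auto
qed

end

context hyperbolic_length
begin

lemma word_map_vanishing_on_coset:
  assumes tf: "torsion_free G" and nvc: "\<not> virtually_cyclic G"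
    and N: "N \<lhd> G" "N \<noteq> {\<one>}" and u: "u \<in> carrier G"
    and \<phi>: "\<phi> \<in> word_maps I" and y: "y \<in> I \<rightarrow> carrier G"
    and zero: "\<And>n. n \<in> N \<Longrightarrow> u \<otimes> n \<noteq> \<one> \<Longrightarrow> \<phi> (y(j := u \<otimes> n)) = \<one>"
    and x: "x \<in> carrier G"
  shows "\<phi> (y(j := x)) = \<one>"
proof -
  interpret N: normal N G by (rule N(1))
  define F where "F = (\<lambda>x. \<phi> (y(j := x)))"
  have "mixed_word_map F" unfolding F_def by (rule word_map_one_variable[OF \<phi> y])
  then obtain g ws where w: "g \<in> carrier G" "snd ` set ws \<subseteq> carrier G"
    and eq: "\<And>x. x \<in> carrier G \<Longrightarrow> F x = mixed_word g ws x"
    by (rule mixed_word_mapE) blast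
  have "mixed_word g ws x = \<one>"
  proof (rule word_vanishing_on_coset[OF tf nvc N u w _ x])
    fix n assume n: "n \<in> N" "u \<otimes> n \<noteq> \<one>"
    have "u \<otimes> n \<in> carrier G" by (rule m_closed[OF u N.mem_carrier[OF n(1)]])
    from zero[OF n] eq[OF this] show "mixed_word g ws (u \<otimes> n) = \<one>" by (simp add: F_def)
  qed
  with eq[OF x] show ?thesis by (simp add: F_def)
qed

text \<open>
  Let \<open>N\<close> be the normal closure of the nontrivial coordinate \<open>U i0\<close>. The coordinates other than
  \<open>i0\<close> can be varied independently within their cosets of \<open>N\<close> while staying in the orbit. If the
  coordinate \<open>j0\<close> has become nontrivial, then \<open>i0\<close> can be varied in a coset of the normal closure
  of that coordinate, so the word is trivial for all values at \<open>i0\<close>. Only then are the other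
  coordinates freed, one by one: by now the word is trivial whenever they lie in their cosets
  of \<open>N\<close> minus \<open>1\<close>, for any value at \<open>i0\<close>, although such points need not lie in the orbit.
\<close>

lemma word_map_vanishing_on_orbit:
  assumes tf: "torsion_free G" and nvc: "\<not> virtually_cyclic G"
    and I: "finite I" "i0 \<in> I" "j0 \<in> I" "j0 \<noteq> i0"
    and Orb: "Orb \<subseteq> (\<Pi>\<^sub>E i\<in>I. carrier G)"
    and closed: "\<And>y i j n. y \<in> Orb \<Longrightarrow> i \<in> I \<Longrightarrow> j \<in> I \<Longrightarrow> i \<noteq> j \<Longrightarrow>
      n \<in> normal_closure (y j) \<Longrightarrow> y(i := y i \<otimes> n) \<in> Orb"
    and U: "U \<in> Orb" "U i0 \<noteq> \<one>"
    and \<phi>: "\<phi> \<in> word_maps I" and zero: "\<And>y. y \<in> Orb \<Longrightarrow> \<phi> y = \<one>"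
    and y: "y \<in> (\<Pi>\<^sub>E i\<in>I. carrier G)"
  shows "\<phi> y = \<one>"
proof -
  let ?X = "\<Pi>\<^sub>E i\<in>I. carrier G"
  have mem: "y i \<in> carrier G" if "y \<in> ?X" "i \<in> I" for y i using that by (auto simp: PiE_iff)
  have upd: "y(i := a) \<in> ?X" if "y \<in> ?X" "i \<in> I" "a \<in> carrier G" for y i a
    using that by (auto simp: PiE_iff extensional_def)
  have fn: "y \<in> I \<rightarrow> carrier G" if "y \<in> ?X" for y using that by (auto simp: PiE_iff)
  have nontriv: "normal_closure v \<noteq> {\<one>}" if "v \<in> carrier G" "v \<noteq> \<one>" for v
    using in_normal_closure[OF that(1)] that(2) by blast
  have UX: "U \<in> ?X" by (rule subsetD[OF Orb U(1)])
  define N where "N = normal_closure (U i0)"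
  have N: "N \<lhd> G" "N \<noteq> {\<one>}"
    unfolding N_def using normal_closure_normal[OF mem[OF UX I(2)]] nontriv[OF mem[OF UX I(2)] U(2)] .
  interpret N: normal N G by (rule N(1))
  have perturb: "y \<in> Orb"
    if "J \<subseteq> I - {i0}" "y \<in> ?X" "\<And>i. i \<in> I - J \<Longrightarrow> y i = U i" "\<And>i. i \<in> J \<Longrightarrow> \<exists>n\<in>N. y i = U i \<otimes> n" for J y
  proof -
    have "finite J" by (rule finite_subset[OF that(1)]) (simp add: I(1))
    then show ?thesis using that
    proof (induction J arbitrary: y)
      case empty
      have "y = U"
      proof (rule PiE_ext[OF empty.prems(2) UX])
        show "y i = U i" if "i \<in> I" for i using empty.prems(3)[of i] that by simp
      qed
      then show ?case using U(1) by simp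
    next
      case (insert j J)
      have j: "j \<in> I" "j \<noteq> i0" using insert.prems(1) by auto
      define y' where "y' = y(j := U j)"
      have "y' \<in> ?X" unfolding y'_def by (rule upd[OF insert.prems(2) j(1) mem[OF UX j(1)]])
      have "y' \<in> Orb"
      proof (rule insert.IH[OF _ \<open>y' \<in> ?X\<close>])
        show "J \<subseteq> I - {i0}" using insert.prems(1) by simp
        show "y' i = U i" if "i \<in> I - J" for i
          using insert.prems(3)[of i] that by (cases "i = j") (simp_all add: y'_def)
        show "\<exists>n\<in>N. y' i = U i \<otimes> n" if "i \<in> J" for i
        proof -
          have "i \<noteq> j" using that insert.hyps(2) by blast
          then show ?thesis using insert.prems(4)[of i] that by (simp add: y'_def)
        qed
      qed
      moreover have "y' i0 = U i0"
      proof -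
        have "i0 \<in> I - insert j J" using insert.prems(1) I(2) j(2) by blast
        then show ?thesis using insert.prems(3) j(2) by (simp add: y'_def)
      qed
      moreover obtain n where n: "n \<in> N" "y j = U j \<otimes> n" using insert.prems(4)[of j] by blast
      ultimately have "y'(j := y' j \<otimes> n) \<in> Orb"
        by (intro closed[OF _ j(1) I(2) j(2)]) (simp_all add: N_def)
      moreover have "y'(j := y' j \<otimes> n) = y"
        unfolding y'_def fun_upd_same fun_upd_upd n(2)[symmetric] by (rule fun_upd_triv)
      ultimately show ?case by simp
    qed
  qed
  have "\<phi> y = \<one>"
    if "J \<subseteq> I - {i0}" "y \<in> ?X" "\<And>i. i \<in> I - {i0} - J \<Longrightarrow> y i \<noteq> \<one> \<and> (\<exists>n\<in>N. y i = U i \<otimes> n)" for J y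
  proof -
    have "finite J" by (rule finite_subset[OF that(1)]) (simp add: I(1))
    then show ?thesis using that
    proof (induction J arbitrary: y)
      case empty
      have yj0: "y j0 \<in> carrier G" "y j0 \<noteq> \<one>"
        using mem[OF empty.prems(2) I(3)] empty.prems(3)[of j0] I by simp_all
      define y' where "y' = y(i0 := U i0)"
      have y'X: "y' \<in> ?X"
        unfolding y'_def by (rule upd[OF empty.prems(2) I(2) mem[OF UX I(2)]])
      have y'Orb: "y' \<in> Orb"
      proof (rule perturb[OF subset_refl y'X])
        show "y' i = U i" if "i \<in> I - (I - {i0})" for i using that by (simp add: y'_def)
        show "\<exists>n\<in>N. y' i = U i \<otimes> n" if "i \<in> I - {i0}" for i
          using that empty.prems(3)[of i] by (simp add: y'_def)
      qed
      have "\<phi> (y'(i0 := y i0)) = \<one>"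
      proof (rule word_map_vanishing_on_coset[OF tf nvc normal_closure_normal[OF yj0(1)] nontriv[OF yj0]
            mem[OF UX I(2)] \<phi> fn[OF y'X] _ mem[OF empty.prems(2) I(2)]])
        fix n assume "n \<in> normal_closure (y j0)"
        then have "y'(i0 := U i0 \<otimes> n) \<in> Orb"
          using closed[OF y'Orb I(2,3), of n] I(4) by (simp add: y'_def)
        then show "\<phi> (y'(i0 := U i0 \<otimes> n)) = \<one>" by (rule zero)
      qed
      then show ?case by (simp add: y'_def)
    next
      case (insert j J)
      have j: "j \<in> I" using insert.prems(1) by auto
      have "\<phi> (y(j := y j)) = \<one>"
      proof (rule word_map_vanishing_on_coset[OF tf nvc N mem[OF UX j] \<phi> fn[OF insert.prems(2)] _
            mem[OF insert.prems(2) j]])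
        fix n assume n: "n \<in> N" "U j \<otimes> n \<noteq> \<one>"
        show "\<phi> (y(j := U j \<otimes> n)) = \<one>"
        proof (rule insert.IH)
          show "J \<subseteq> I - {i0}" using insert.prems(1) by simp
          show "y(j := U j \<otimes> n) \<in> ?X"
            using mem[OF UX j] N.mem_carrier[OF n(1)] by (intro upd insert.prems(2) j m_closed)
          show "(y(j := U j \<otimes> n)) i \<noteq> \<one> \<and> (\<exists>n'\<in>N. (y(j := U j \<otimes> n)) i = U i \<otimes> n')"
            if "i \<in> I - {i0} - J" for i
            using that n insert.prems(3)[of i] by (cases "i = j") auto
        qed
      qed
      then show ?case by simp
    qed
  qed
  from this[OF subset_refl y] show ?thesis by simp
qed

end

section \<open>The word length of a hyperbolic group\<close>

context group
begin

abbreviation word_product :: "'a list \<Rightarrow> 'a" where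
  "word_product ws \<equiv> foldr (\<otimes>) ws \<one>"

lemma word_product_closed [simp]: "set ws \<subseteq> carrier G \<Longrightarrow> word_product ws \<in> carrier G"
  by (induction ws) auto

lemma word_product_append:
  "set ws \<subseteq> carrier G \<Longrightarrow> set vs \<subseteq> carrier G \<Longrightarrow> word_product (ws @ vs) = word_product ws \<otimes> word_product vs"
  by (induction ws) (auto simp: m_assoc)

lemma word_product_rev_inv:
  "set ws \<subseteq> carrier G \<Longrightarrow> word_product (rev (map (m_inv G) ws)) = inv (word_product ws)"
proof (induction ws)
  case (Cons w ws)
  then have "set (rev (map (m_inv G) ws)) \<subseteq> carrier G" by auto
  with Cons show ?case by (simp add: word_product_append inv_mult_group del: foldr_append)
qed simp

context
  fixes S
  assumes fin: "finite S" and S: "S \<subseteq> carrier G" and gen: "generate G S = carrier G"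
begin

private abbreviation "alphabet \<equiv> S \<union> m_inv G ` S"
private abbreviation "wl \<equiv> word_length G S"

private lemma alphabet: "alphabet \<subseteq> carrier G"
  using S by auto

private lemma alphabet_inv: "x \<in> alphabet \<Longrightarrow> inv x \<in> alphabet"
  using S by (auto simp: subset_iff)

private lemma ex_word:
  assumes "x \<in> carrier G"
  shows "\<exists>ws. set ws \<subseteq> alphabet \<and> word_product ws = x"
proof -
  from assms have "x \<in> generate G S" by (simp add: gen)
  then show ?thesis
  proof induction
    case one
    show ?case by (intro exI[of _ "[]"]) auto
  next
    case (incl h)
    then show ?case using S by (intro exI[of _ "[h]"]) auto
  next
    case (inv h)
    then show ?case using S by (intro exI[of _ "[inv h]"]) auto
  next
    case (eng h1 h2)
    then obtain ws vs where w: "set ws \<subseteq> alphabet" "word_product ws = h1"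
      "set vs \<subseteq> alphabet" "word_product vs = h2" by blast
    then have "word_product (ws @ vs) = h1 \<otimes> h2"
      using word_product_append[of ws vs] alphabet by (metis subset_trans)
    moreover have "set (ws @ vs) \<subseteq> alphabet" using w by simp
    ultimately show ?case by blast
  qed
qed

private lemma wl_le: "set ws \<subseteq> alphabet \<Longrightarrow> wl (word_product ws) \<le> length ws"
  unfolding word_length_def by (intro Least_le) auto

private lemma wl_word:
  assumes "x \<in> carrier G"
  obtains ws where "set ws \<subseteq> alphabet" "length ws = wl x" "word_product ws = x"
proof -
  have "\<exists>n ws. set ws \<subseteq> alphabet \<and> length ws = n \<and> word_product ws = x"
    using ex_word[OF assms] by blast
  from LeastI_ex[OF this] show thesis
    unfolding word_length_def[symmetric] using that by blast
qed

private lemma wl_mult: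
  assumes x: "x \<in> carrier G" and y: "y \<in> carrier G"
  shows "wl (x \<otimes> y) \<le> wl x + wl y"
proof -
  obtain ws where ws: "set ws \<subseteq> alphabet" "length ws = wl x" "word_product ws = x" using wl_word[OF x] .
  obtain vs where vs: "set vs \<subseteq> alphabet" "length vs = wl y" "word_product vs = y" using wl_word[OF y] .
  have "word_product (ws @ vs) = x \<otimes> y"
    using ws vs alphabet word_product_append[of ws vs] by (metis subset_trans)
  then show ?thesis using wl_le[of "ws @ vs"] ws vs by simp
qed

private lemma wl_inv_le:
  assumes "x \<in> carrier G"
  shows "wl (inv x) \<le> wl x"
proof -
  obtain ws where ws: "set ws \<subseteq> alphabet" "length ws = wl x" "word_product ws = x" using wl_word[OF assms] .
  have "set (rev (map (m_inv G) ws)) \<subseteq> alphabet" using ws(1) alphabet_inv by auto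
  from wl_le[OF this] show ?thesis
    using ws alphabet word_product_rev_inv[of ws] by (metis length_map length_rev subset_trans)
qed

private lemma wl_geodesic:
  assumes "x \<in> carrier G" "n \<le> wl x"
  shows "\<exists>p \<in> carrier G. wl p = n \<and> wl (inv p \<otimes> x) = wl x - n"
proof -
  obtain ws where ws: "set ws \<subseteq> alphabet" "length ws = wl x" "word_product ws = x" using wl_word[OF assms(1)] .
  define p q where "p = word_product (take n ws)" and "q = word_product (drop n ws)"
  have sub: "set (take n ws) \<subseteq> alphabet" "set (drop n ws) \<subseteq> alphabet"
    using ws(1) set_take_subset[of n ws] set_drop_subset[of n ws] by blast+
  then have [simp]: "p \<in> carrier G" "q \<in> carrier G"
    using alphabet unfolding p_def q_def by (metis word_product_closed subset_trans)+
  have x: "x = p \<otimes> q"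
    unfolding p_def q_def ws(3)[symmetric]
    using sub alphabet word_product_append[of "take n ws" "drop n ws"] by (metis append_take_drop_id subset_trans)
  then have "inv p \<otimes> x = q" by (simp flip: m_assoc)
  moreover have "wl p \<le> n" "wl q \<le> wl x - n"
    using wl_le[OF sub(1)] wl_le[OF sub(2)] ws(2) assms(2) by (simp_all add: p_def q_def)
  moreover have "wl x \<le> wl p + wl q" unfolding x by (rule wl_mult) auto
  ultimately show ?thesis using assms(2) by (intro bexI[of _ p]) auto
qed

private lemma wl_finite_ball: "finite {x \<in> carrier G. wl x \<le> n}"
proof (rule finite_subset)
  show "{x \<in> carrier G. wl x \<le> n} \<subseteq> word_product ` {ws. set ws \<subseteq> alphabet \<and> length ws \<le> n}"
  proof
    fix x assume "x \<in> {x \<in> carrier G. wl x \<le> n}"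
    then have x: "x \<in> carrier G" "wl x \<le> n" by auto
    obtain ws where "set ws \<subseteq> alphabet" "length ws = wl x" "word_product ws = x" using wl_word[OF x(1)] .
    then show "x \<in> word_product ` {ws. set ws \<subseteq> alphabet \<and> length ws \<le> n}" using x(2) by auto
  qed
  show "finite (word_product ` {ws. set ws \<subseteq> alphabet \<and> length ws \<le> n})"
    using fin by (intro finite_imageI finite_lists_length_le) auto
qed

lemma hyperbolic_length_word_length:
  assumes "gromov_hyperbolic (carrier G) (word_metric G S)"
  shows "\<exists>\<delta>. hyperbolic_length G (\<lambda>x. real (word_length G S x)) \<delta>"
proof -
  obtain \<delta> where \<delta>: "\<And>w x y z. w \<in> carrier G \<Longrightarrow> x \<in> carrier G \<Longrightarrow> y \<in> carrier G \<Longrightarrow> z \<in> carrier G \<Longrightarrow>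
      gromov_product (word_metric G S) w x z \<ge>
        min (gromov_product (word_metric G S) w x y) (gromov_product (word_metric G S) w y z) - \<delta>"
    using assms unfolding gromov_hyperbolic_def by blast
  have metric: "(\<lambda>x y. real (wl (inv x \<otimes> y))) = word_metric G S"
    by (simp add: word_metric_def fun_eq_iff)
  have "hyperbolic_length G (\<lambda>x. real (wl x)) (max \<delta> 0)"
  proof (intro hyperbolic_length.intro hyperbolic_length_axioms.intro)
    show "real (wl \<one>) = 0" using wl_le[of "[]"] by simp
    show "real (wl (inv x)) = real (wl x)" if "x \<in> carrier G" for x
      using wl_inv_le[OF that] wl_inv_le[of "inv x"] that by simp
    show "real (wl (x \<otimes> y)) \<le> real (wl x) + real (wl y)" if "x \<in> carrier G" "y \<in> carrier G" for x y
      using wl_mult[OF that] by linarith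
    show "finite {x \<in> carrier G. real (wl x) \<le> r}" for r
      by (rule finite_subset[OF _ wl_finite_ball[of "nat \<lfloor>r\<rfloor>"]]) (auto simp: le_nat_floor)
    show "\<exists>p\<in>carrier G. real (wl p) = real n \<and> real (wl (inv p \<otimes> x)) = real (wl x) - real n"
      if "x \<in> carrier G" "real n \<le> real (wl x)" for x n
      using wl_geodesic[of x n] that by (auto simp: of_nat_diff)
    show "max \<delta> 0 \<ge> 0" by simp
    show "gromov_product (\<lambda>x y. real (wl (inv x \<otimes> y))) w x z \<ge>
        min (gromov_product (\<lambda>x y. real (wl (inv x \<otimes> y))) w x y)
            (gromov_product (\<lambda>x y. real (wl (inv x \<otimes> y))) w y z) - max \<delta> 0"
      if "w \<in> carrier G" "x \<in> carrier G" "y \<in> carrier G" "z \<in> carrier G" for w x y z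
      using \<delta>[OF that] unfolding metric by linarith
  qed (rule is_group)
  then show ?thesis by blast
qed

end

section \<open>Andrews-Curtis transformations\<close>

lemma direct_power_mem:
  assumes "u \<in> carrier (direct_power G k)" "i \<in> {1..k}"
  shows "u i \<in> carrier G"
  using assms by (auto simp: PiE_iff)

lemma AC_moves_cases:
  assumes "m \<in> AC_moves G k"
  obtains
    (R) i j where "m = AC_right G k i j" "i \<in> {1..k}" "j \<in> {1..k}" "i \<noteq> j"
  | (R_inv) i j where "m = AC_right_inv G k i j" "i \<in> {1..k}" "j \<in> {1..k}" "i \<noteq> j"
  | (L) i j where "m = AC_left G k i j" "i \<in> {1..k}" "j \<in> {1..k}" "i \<noteq> j"
  | (L_inv) i j where "m = AC_left_inv G k i j" "i \<in> {1..k}" "j \<in> {1..k}" "i \<noteq> j"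
  | (Inv) i where "m = AC_inv G k i" "i \<in> {1..k}"
  | (C) i w where "m = AC_conj G k i w" "i \<in> {1..k}" "w \<in> carrier G"
  using assms unfolding AC_moves_def by blast

text \<open>
  Inverses of moves are moves. Hence the generated group consists of composites of moves, and the
  induction over it in \<open>FAC_coordinatewise_word\<close> meets inverses of moves only in the form of moves.
\<close>

lemma AC_moves_inverse:
  assumes "m \<in> AC_moves G k"
  shows "\<exists>m' \<in> AC_moves G k. \<forall>u \<in> carrier (direct_power G k). m' (m u) = u"
proof -
  let ?X = "carrier (direct_power G k)"
  have upd: "u(i := a) \<in> ?X" if "u \<in> ?X" "i \<in> {1..k}" "a \<in> carrier G" for u i a
    using that by (auto simp: PiE_iff extensional_def)
  note simps = upd direct_power_mem m_assoc AC_right_def AC_right_inv_def AC_left_def AC_left_inv_def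
    AC_inv_def AC_conj_def
  have cancel: "inv x \<otimes> (x \<otimes> y) = y" "x \<otimes> (inv x \<otimes> y) = y"
    if "x \<in> carrier G" "y \<in> carrier G" for x y
    using that by (simp_all flip: m_assoc)
  from assms show ?thesis
  proof (cases rule: AC_moves_cases)
    case (R i j)
    have "AC_right_inv G k i j \<in> AC_moves G k"
      unfolding AC_moves_def using R by blast
    moreover have "\<forall>u \<in> ?X. AC_right_inv G k i j (m u) = u"
      using R by (simp add: simps del: carrier_product_group One_nat_def)
    ultimately show ?thesis by blast
  next
    case (R_inv i j)
    have "AC_right G k i j \<in> AC_moves G k"
      unfolding AC_moves_def using R_inv by blast
    moreover have "\<forall>u \<in> ?X. AC_right G k i j (m u) = u"
      using R_inv by (simp add: simps del: carrier_product_group One_nat_def)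
    ultimately show ?thesis by blast
  next
    case (L i j)
    have "AC_left_inv G k i j \<in> AC_moves G k"
      unfolding AC_moves_def using L by blast
    moreover have "\<forall>u \<in> ?X. AC_left_inv G k i j (m u) = u"
      using L by (simp add: simps cancel del: carrier_product_group One_nat_def)
    ultimately show ?thesis by blast
  next
    case (L_inv i j)
    have "AC_left G k i j \<in> AC_moves G k"
      unfolding AC_moves_def using L_inv by blast
    moreover have "\<forall>u \<in> ?X. AC_left G k i j (m u) = u"
      using L_inv by (simp add: simps cancel del: carrier_product_group One_nat_def)
    ultimately show ?thesis by blast
  next
    case (Inv i)
    have "AC_inv G k i \<in> AC_moves G k"
      unfolding AC_moves_def using Inv by blast
    moreover have "\<forall>u \<in> ?X. AC_inv G k i (m u) = u"
      using Inv by (simp add: simps del: carrier_product_group One_nat_def)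
    ultimately show ?thesis by blast
  next
    case (C i w)
    have "AC_conj G k i (inv w) \<in> AC_moves G k"
      unfolding AC_moves_def using C by (blast intro: inv_closed)
    moreover have "\<forall>u \<in> ?X. AC_conj G k i (inv w) (m u) = u"
      using C by (simp add: simps cancel del: carrier_product_group One_nat_def)
    ultimately show ?thesis by blast
  qed
qed

definition coordinatewise_word :: "nat \<Rightarrow> ((nat \<Rightarrow> 'a) \<Rightarrow> nat \<Rightarrow> 'a) \<Rightarrow> bool" where
  "coordinatewise_word k f \<longleftrightarrow> (\<forall>i \<in> {1..k}. \<exists>\<phi> \<in> word_maps {1..k}.
     \<forall>u \<in> carrier (direct_power G k). f u i = \<phi> u)"

lemma word_map_subst:
  assumes "\<phi> \<in> word_maps {1..k}" and f: "coordinatewise_word k f"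
  shows "\<exists>\<psi> \<in> word_maps {1..k}. \<forall>u \<in> carrier (direct_power G k). \<phi> (f u) = \<psi> u"
  using assms(1)
proof induction
  case (const g)
  then show ?case by (intro bexI[OF _ word_maps.const]) auto
next
  case (proj i)
  then show ?case using f unfolding coordinatewise_word_def by blast
next
  case (mult \<phi> \<phi>')
  then obtain \<psi> \<psi>' where "\<psi> \<in> word_maps {1..k}" "\<psi>' \<in> word_maps {1..k}"
    "\<forall>u \<in> carrier (direct_power G k). \<phi> (f u) = \<psi> u" "\<forall>u \<in> carrier (direct_power G k). \<phi>' (f u) = \<psi>' u"
    by blast
  then show ?case by (intro bexI[of _ "\<lambda>u. \<psi> u \<otimes> \<psi>' u"] word_maps.mult) auto
next
  case (inverse \<phi>)
  then obtain \<psi> where "\<psi> \<in> word_maps {1..k}" "\<forall>u \<in> carrier (direct_power G k). \<phi> (f u) = \<psi> u"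
    by blast
  then show ?case by (intro bexI[of _ "\<lambda>u. inv (\<psi> u)"] word_maps.inverse) auto
qed

lemma coordinatewise_word_comp:
  assumes "coordinatewise_word k f" "coordinatewise_word k f'"
    and "\<And>u. u \<in> carrier (direct_power G k) \<Longrightarrow> f' u \<in> carrier (direct_power G k)"
    and "\<And>u. u \<in> carrier (direct_power G k) \<Longrightarrow> h u = f (f' u)"
  shows "coordinatewise_word k h"
  unfolding coordinatewise_word_def
proof
  fix i assume "i \<in> {1..k}"
  then obtain \<phi> where "\<phi> \<in> word_maps {1..k}" "\<forall>u \<in> carrier (direct_power G k). f u i = \<phi> u"
    using assms(1) unfolding coordinatewise_word_def by blast
  then show "\<exists>\<phi> \<in> word_maps {1..k}. \<forall>u \<in> carrier (direct_power G k). h u i = \<phi> u"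
    using word_map_subst[OF _ assms(2)] assms(3,4) by metis
qed

lemma coordinatewise_word_update:
  assumes "\<phi> \<in> word_maps {1..k}"
    and "\<And>u. u \<in> carrier (direct_power G k) \<Longrightarrow> f u = u(i := \<phi> u)"
  shows "coordinatewise_word k f"
  unfolding coordinatewise_word_def
proof
  fix l assume l: "l \<in> {1..k}"
  show "\<exists>\<phi> \<in> word_maps {1..k}. \<forall>u \<in> carrier (direct_power G k). f u l = \<phi> u"
  proof (cases "l = i")
    case True
    then show ?thesis using assms by (intro bexI[of _ \<phi>]) auto
  next
    case False
    then show ?thesis using assms(2) word_maps.proj[OF l] by (intro bexI[of _ "\<lambda>u. u l"]) auto
  qed
qed

lemma AC_moves_coordinatewise_word:
  assumes "m \<in> AC_moves G k"
  shows "coordinatewise_word k m"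
proof -
  note update = coordinatewise_word_update[where k = k and f = m]
  from assms show ?thesis
  proof (cases rule: AC_moves_cases)
    case (R i j)
    show ?thesis
    proof (rule update[of "\<lambda>u. u i \<otimes> u j" i])
      show "(\<lambda>u. u i \<otimes> u j) \<in> word_maps {1..k}"
        using R by (intro word_maps.mult word_maps.proj)
    qed (simp add: R(1) AC_right_def)
  next
    case (R_inv i j)
    show ?thesis
    proof (rule update[of "\<lambda>u. u i \<otimes> inv (u j)" i])
      show "(\<lambda>u. u i \<otimes> inv (u j)) \<in> word_maps {1..k}"
        using R_inv by (intro word_maps.mult word_maps.inverse word_maps.proj)
    qed (simp add: R_inv(1) AC_right_inv_def)
  next
    case (L i j)
    show ?thesis
    proof (rule update[of "\<lambda>u. u j \<otimes> u i" i])
      show "(\<lambda>u. u j \<otimes> u i) \<in> word_maps {1..k}"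
        using L by (intro word_maps.mult word_maps.proj)
    qed (simp add: L(1) AC_left_def)
  next
    case (L_inv i j)
    show ?thesis
    proof (rule update[of "\<lambda>u. inv (u j) \<otimes> u i" i])
      show "(\<lambda>u. inv (u j) \<otimes> u i) \<in> word_maps {1..k}"
        using L_inv by (intro word_maps.mult word_maps.inverse word_maps.proj)
    qed (simp add: L_inv(1) AC_left_inv_def)
  next
    case (Inv i)
    show ?thesis
    proof (rule update[of "\<lambda>u. inv (u i)" i])
      show "(\<lambda>u. inv (u i)) \<in> word_maps {1..k}"
        using Inv by (intro word_maps.inverse word_maps.proj)
    qed (simp add: Inv(1) AC_inv_def)
  next
    case (C i w)
    show ?thesis
    proof (rule update[of "\<lambda>u. inv w \<otimes> u i \<otimes> w" i])
      show "(\<lambda>u. inv w \<otimes> u i \<otimes> w) \<in> word_maps {1..k}"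
        using C by (intro word_maps.mult word_maps.const word_maps.proj inv_closed)
    qed (simp add: C(1) AC_conj_def)
  qed
qed

lemma FAC_apply_mem:
  assumes "f \<in> carrier (FAC G k)" "u \<in> carrier (direct_power G k)"
  shows "f u \<in> carrier (direct_power G k)"
proof -
  interpret group_action "FAC G k" "carrier (direct_power G k)" "\<lambda>f. f"
    by (rule group_action_FAC)
  show ?thesis using element_image[OF assms refl] .
qed

lemma FAC_in_BijGroup:
  "f \<in> carrier (FAC G k) \<Longrightarrow> f \<in> carrier (BijGroup (carrier (direct_power G k)))"
  unfolding carrier_FAC[OF is_group]
  using group.generate_in_carrier[OF group_BijGroup AC_moves_in_BijGroup[OF is_group]] .

lemma BijGroup_mult_apply:
  "f \<in> carrier (BijGroup A) \<Longrightarrow> f' \<in> carrier (BijGroup A) \<Longrightarrow> u \<in> A \<Longrightarrow>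
    (f \<otimes>\<^bsub>BijGroup A\<^esub> f') u = f (f' u)"
  by (simp add: BijGroup_def compose_def)

lemma FAC_mult_move:
  assumes f: "f \<in> carrier (FAC G k)" and m: "m \<in> AC_moves G k"
  shows "\<exists>f' \<in> carrier (FAC G k). \<forall>u \<in> carrier (direct_power G k). f' u = m (f u)"
proof -
  let ?B = "BijGroup (carrier (direct_power G k))"
  have "m \<otimes>\<^bsub>?B\<^esub> f \<in> carrier (FAC G k)"
    using generate.eng[OF generate.incl[OF m]] f unfolding carrier_FAC[OF is_group] by blast
  moreover have "(m \<otimes>\<^bsub>?B\<^esub> f) u = m (f u)" if "u \<in> carrier (direct_power G k)" for u
    using AC_moves_in_BijGroup[OF is_group] m FAC_in_BijGroup[OF f] that
    by (intro BijGroup_mult_apply) auto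
  ultimately show ?thesis by blast
qed

lemma FAC_coordinatewise_word:
  assumes "f \<in> carrier (FAC G k)"
  shows "coordinatewise_word k f"
proof -
  let ?X = "carrier (direct_power G k)"
  let ?B = "BijGroup ?X"
  interpret B: group ?B by (rule group_BijGroup)
  note moves = AC_moves_in_BijGroup[OF is_group, of k]
  from assms have "f \<in> generate ?B (AC_moves G k)" by (simp only: carrier_FAC[OF is_group])
  then show ?thesis
  proof induction
    case one
    show ?case
      unfolding coordinatewise_word_def using word_maps.proj by (auto simp: BijGroup_def)
  next
    case (incl m)
    then show ?case by (rule AC_moves_coordinatewise_word)
  next
    case (inv m)
    then obtain m' where m': "m' \<in> AC_moves G k" "\<forall>u \<in> ?X. m' (m u) = u"
      using AC_moves_inverse by blast
    have B: "m \<in> carrier ?B" "m' \<in> carrier ?B" using moves inv m'(1) by blast+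
    then have "m' \<otimes>\<^bsub>?B\<^esub> m = (\<lambda>u\<in>?X. m' (m u))"
      by (simp add: BijGroup_def compose_def)
    also have "\<dots> = (\<lambda>u\<in>?X. u)"
      by (rule restrict_ext) (use m'(2) in blast)
    also have "\<dots> = \<one>\<^bsub>?B\<^esub>" by (simp add: BijGroup_def)
    finally have "inv\<^bsub>?B\<^esub> m = m'" using B by (intro B.inv_equality)
    then show ?case using AC_moves_coordinatewise_word[OF m'(1)] by simp
  next
    case (eng f f')
    then have ff': "f \<in> carrier (FAC G k)" "f' \<in> carrier (FAC G k)"
      by (simp_all only: carrier_FAC[OF is_group])
    show ?case
    proof (rule coordinatewise_word_comp[OF eng.IH])
      fix u assume u: "u \<in> ?X"
      show "f' u \<in> ?X" by (rule FAC_apply_mem[OF ff'(2) u])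
      show "(f \<otimes>\<^bsub>?B\<^esub> f') u = f (f' u)"
        by (rule BijGroup_mult_apply[OF FAC_in_BijGroup[OF ff'(1)] FAC_in_BijGroup[OF ff'(2)] u])
    qed
  qed
qed

text \<open>
  Conjugate coordinate \<open>j\<close>, multiply coordinate \<open>i\<close> by it, and undo the conjugation: this multiplies
  coordinate \<open>i\<close> by a conjugate of coordinate \<open>j\<close> and restores the latter. Products of conjugates and of
  their inverses are obtained by repetition.
\<close>

lemma AC_orbit_normal_closure:
  assumes Orb: "\<And>m y. m \<in> AC_moves G k \<Longrightarrow> y \<in> Orb \<Longrightarrow> m y \<in> Orb"
    and sub: "Orb \<subseteq> carrier (direct_power G k)"
    and y: "y \<in> Orb" and ij: "i \<in> {1..k}" "j \<in> {1..k}" "i \<noteq> j" and n: "n \<in> normal_closure (y j)"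
  shows "y(i := y i \<otimes> n) \<in> Orb"
proof -
  have yX: "y \<in> carrier (direct_power G k)" using y sub by blast
  define v where "v = y j"
  have v [simp]: "v \<in> carrier G" using direct_power_mem[OF yX ij(2)] by (simp add: v_def)
  have mem: "x l \<in> carrier G" if "x \<in> Orb" "l \<in> {1..k}" for x l
    using that sub direct_power_mem by blast
  have conj: "x(j := g \<otimes> x j \<otimes> inv g) \<in> Orb" if "x \<in> Orb" "g \<in> carrier G" for x g
  proof -
    have "AC_conj G k j (inv g) \<in> AC_moves G k" using ij(2) that(2) unfolding AC_moves_def by blast
    from Orb[OF this that(1)] show ?thesis using that sub by (auto simp: AC_conj_def)
  qed
  have right: "x(i := x i \<otimes> x j) \<in> Orb" if "x \<in> Orb" for x
  proof -
    have "AC_right G k i j \<in> AC_moves G k" using ij unfolding AC_moves_def by blast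
    from Orb[OF this that] show ?thesis using that sub by (auto simp: AC_right_def)
  qed
  have right_inv: "x(i := x i \<otimes> inv (x j)) \<in> Orb" if "x \<in> Orb" for x
  proof -
    have "AC_right_inv G k i j \<in> AC_moves G k" using ij unfolding AC_moves_def by blast
    from Orb[OF this that] show ?thesis using that sub by (auto simp: AC_right_inv_def)
  qed
  have undo: "x(i := x i \<otimes> h) \<in> Orb"
    if x: "x \<in> Orb" "x j = v" and g: "g \<in> carrier G"
      and z: "(x(j := g \<otimes> v \<otimes> inv g))(i := x i \<otimes> h) \<in> Orb" for x g h
  proof -
    have "inv g \<otimes> (g \<otimes> v \<otimes> inv g) \<otimes> g = v"
      using g by (simp add: m_assoc) (simp flip: m_assoc)
    moreover have "((x(j := g \<otimes> v \<otimes> inv g))(i := x i \<otimes> h))(j := v) = x(i := x i \<otimes> h)"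
      using x(2) ij(3) by auto
    ultimately show ?thesis
      using conj[OF z, of "inv g"] g ij(3) by simp
  qed
  have "n \<in> generate G ((\<lambda>g. g \<otimes> v \<otimes> inv g) ` carrier G)"
    using n by (simp add: normal_closure_def v_def)
  then have "\<forall>x \<in> Orb. x j = v \<longrightarrow> x(i := x i \<otimes> n) \<in> Orb"
  proof induction
    case one
    show ?case using mem ij(1) by simp
  next
    case (incl h)
    then obtain g where g: "g \<in> carrier G" "h = g \<otimes> v \<otimes> inv g" by blast
    have "x(i := x i \<otimes> h) \<in> Orb" if x: "x \<in> Orb" "x j = v" for x
      using right[OF conj[OF x(1) g(1)]] x ij(3) by (intro undo[OF x g(1)]) (simp add: g(2))
    then show ?case by blast
  next
    case (inv h)
    then obtain g where g: "g \<in> carrier G" "h = g \<otimes> v \<otimes> inv g" by blast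
    have "x(i := x i \<otimes> inv h) \<in> Orb" if x: "x \<in> Orb" "x j = v" for x
      using right_inv[OF conj[OF x(1) g(1)]] x ij(3) by (intro undo[OF x g(1)]) (simp add: g(2))
    then show ?case by blast
  next
    case (eng h1 h2)
    have conj_sub: "(\<lambda>g. g \<otimes> v \<otimes> inv g) ` carrier G \<subseteq> carrier G" by auto
    have h: "h1 \<in> carrier G" "h2 \<in> carrier G"
      using eng.hyps by (simp_all only: generate_in_carrier[OF conj_sub])
    have "x(i := x i \<otimes> (h1 \<otimes> h2)) \<in> Orb" if x: "x \<in> Orb" "x j = v" for x
    proof -
      have "x(i := x i \<otimes> h1) \<in> Orb" using eng.IH(1) x by blast
      then have "(x(i := x i \<otimes> h1))(i := (x i \<otimes> h1) \<otimes> h2) \<in> Orb"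
        using eng.IH(2) x ij(3) by (metis fun_upd_other fun_upd_same)
      then show ?thesis using h mem[OF x(1) ij(1)] by (simp add: m_assoc)
    qed
    then show ?case by blast
  qed
  then show ?thesis using y by (simp add: v_def)
qed

end

section \<open>Faithfulness on orbits\<close>

context hyperbolic_length
begin

text \<open>
  The word map whose triviality expresses that \<open>f\<close> fixes coordinate \<open>i\<close> is trivial on the orbit, hence
  everywhere. The second index \<open>j0\<close> exists because \<open>k \<ge> 2\<close>.
\<close>

lemma FAC_faithful_on_orbit:
  assumes tf: "torsion_free G" and nvc: "\<not> virtually_cyclic G" and "k \<ge> 2"
    and Orb: "Orb \<in> FAC_orbits G k" and nontriv: "Orb \<noteq> {\<one>\<^bsub>direct_power G k\<^esub>}"
    and f: "f \<in> carrier (FAC G k)" and fix_Orb: "\<forall>u\<in>Orb. f u = u"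
  shows "f = \<one>\<^bsub>FAC G k\<^esub>"
proof -
  let ?X = "carrier (direct_power G k)"
  interpret act: group_action "FAC G k" ?X "\<lambda>f. f" by (rule group_action_FAC)
  obtain u0 where u0: "u0 \<in> ?X" and Orb_eq: "Orb = {f u0 |f. f \<in> carrier (FAC G k)}"
    using Orb unfolding orbits_def orbit_def by blast
  have sub: "Orb \<subseteq> ?X" unfolding Orb_eq using FAC_apply_mem u0 by blast
  have moves: "m y \<in> Orb" if "m \<in> AC_moves G k" "y \<in> Orb" for m y
  proof -
    obtain h where h: "h \<in> carrier (FAC G k)" "y = h u0" using \<open>y \<in> Orb\<close> unfolding Orb_eq by blast
    obtain h' where "h' \<in> carrier (FAC G k)" "h' u0 = m (h u0)"
      using FAC_mult_move[OF h(1) \<open>m \<in> AC_moves G k\<close>] u0 by blast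
    then show ?thesis unfolding Orb_eq h(2) by (metis (mono_tags, lifting) mem_Collect_eq)
  qed
  have closed: "y(i := y i \<otimes> n) \<in> Orb"
    if "y \<in> Orb" "i \<in> {1..k}" "j \<in> {1..k}" "i \<noteq> j" "n \<in> normal_closure (y j)" for y i j n
  proof (rule AC_orbit_normal_closure[of k Orb])
    show "m x \<in> Orb" if "m \<in> AC_moves G k" "x \<in> Orb" for m x
      using that by (rule moves)
  qed (fact sub that)+
  have "u0 \<in> Orb" using act.orbit_refl[OF u0] by (simp add: Orb_eq orbit_def)
  then obtain U where U: "U \<in> Orb" "U \<noteq> \<one>\<^bsub>direct_power G k\<^esub>" using nontriv by blast
  obtain i0 where i0: "i0 \<in> {1..k}" "U i0 \<noteq> \<one>"
  proof -
    have "\<exists>i \<in> {1..k}. U i \<noteq> \<one>"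
    proof (rule ccontr)
      assume "\<not> ?thesis"
      then have one: "U i = \<one>" if "i \<in> {1..k}" for i using that by blast
      have "U \<in> ({1..k} \<rightarrow>\<^sub>E carrier G)" using U(1) sub by auto
      moreover have "(\<lambda>i\<in>{1..k}. \<one>) \<in> ({1..k} \<rightarrow>\<^sub>E carrier G)" by simp
      ultimately have "U = (\<lambda>i\<in>{1..k}. \<one>)"
        by (rule PiE_ext) (simp add: one)
      then have "U = \<one>\<^bsub>direct_power G k\<^esub>" by simp
      with U(2) show False by simp
    qed
    then show thesis using that by blast
  qed
  obtain j0 where j0: "j0 \<in> {1..k}" "j0 \<noteq> i0"
  proof (cases "i0 = 1")
    case True
    then show thesis using that[of 2] \<open>k \<ge> 2\<close> by simp
  next
    case False
    then show thesis using that[of 1] \<open>k \<ge> 2\<close> by simp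
  qed
  have fixed: "f u i = u i" if u: "u \<in> ?X" and i: "i \<in> {1..k}" for u i
  proof -
    obtain \<phi> where \<phi>: "\<phi> \<in> word_maps {1..k}" "\<And>u. u \<in> ?X \<Longrightarrow> f u i = \<phi> u"
      using FAC_coordinatewise_word[OF f] i unfolding coordinatewise_word_def by blast
    let ?\<psi> = "\<lambda>u. \<phi> u \<otimes> inv (u i)"
    have "?\<psi> u = \<one>"
    proof (rule word_map_vanishing_on_orbit[where \<phi> = ?\<psi> and y = u,
          OF tf nvc finite_atLeastAtMost i0(1) j0 _ closed U(1) i0(2)])
      show "Orb \<subseteq> ({1..k} \<rightarrow>\<^sub>E carrier G)" "u \<in> ({1..k} \<rightarrow>\<^sub>E carrier G)"
        using sub u by simp_all
      show "?\<psi> \<in> word_maps {1..k}"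
        using \<phi>(1) i by (intro word_maps.mult word_maps.inverse word_maps.proj)
      fix y assume "y \<in> Orb"
      then have "y \<in> ?X" "f y = y" using sub fix_Orb by auto
      then show "?\<psi> y = \<one>"
        using \<phi>(2)[of y] r_inv[OF direct_power_mem[of y k i]] i by simp
    qed
    moreover have "f u i \<in> carrier G" "u i \<in> carrier G"
      using FAC_apply_mem[OF f u] u i direct_power_mem by blast+
    ultimately show ?thesis
      using \<phi>(2)[OF u] inv_equality[of "f u i" "inv (u i)"] by simp
  qed
  have "f = (\<lambda>u \<in> ?X. u)"
  proof
    fix u
    show "f u = (\<lambda>u \<in> ?X. u) u"
    proof (cases "u \<in> ?X")
      case True
      have "f u \<in> ({1..k} \<rightarrow>\<^sub>E carrier G)" "u \<in> ({1..k} \<rightarrow>\<^sub>E carrier G)"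
        using FAC_apply_mem[OF f True] True by simp_all
      then have "f u = u" by (rule PiE_ext) (rule fixed[OF True])
      then show ?thesis using True by simp
    next
      case False
      then show ?thesis
        using FAC_in_BijGroup[OF f] by (auto simp: BijGroup_def Bij_def extensional_def)
    qed
  qed
  then show "f = \<one>\<^bsub>FAC G k\<^esub>" by (simp add: FAC_def BijGroup_def)
qed

end

theorem theorem2p1:
  fixes G :: "('a, 'b) monoid_scheme" and k :: nat
  assumes "hyperbolic_group G"
    and "torsion_free G"
    and "\<not> virtually_cyclic G"
    and "k \<ge> 2"
  shows "\<forall>Orb \<in> FAC_orbits G k. Orb \<noteq> {\<one>\<^bsub>direct_power G k\<^esub>} \<longrightarrow>
           (\<forall>f \<in> carrier (FAC G k). (\<forall>u\<in>Orb. f u = u) \<longrightarrow> f = \<one>\<^bsub>FAC G k\<^esub>)"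
proof -
  obtain S where "group G" and S: "finite S" "S \<subseteq> carrier G" "generate G S = carrier G"
    "gromov_hyperbolic (carrier G) (word_metric G S)"
    using assms(1) unfolding hyperbolic_group_def by blast
  obtain \<delta> where "hyperbolic_length G (\<lambda>x. real (word_length G S x)) \<delta>"
    using group.hyperbolic_length_word_length[OF \<open>group G\<close> S] by blast
  from hyperbolic_length.FAC_faithful_on_orbit[OF this assms(2-4)] show ?thesis by blast
qed

end
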